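(* For each $\varepsilon > 0$ there is a $K$ such that for $p \ge K/\sqrt{n}$, \[ \Pr\big(G_{n,p} \text{ contains the square of a Hamilton cycle}\big) \ge 1 - \varepsilon \] for all sufficiently large $n$.
   Context: $G_{n,p}$ is the binomial random graph on vertex set $\{1,\dots,n\}$ in which each of the $\binom n2$ possible edges is present independently with probability $p$. The square of a graph $G$ is the graph on $V(G)$ in which two vertices are adjacent iff their distance in $G$ is at most $2$; the square of a Hamilton cycle of $K_n$ is the square of an $n$-vertex cycle on the vertex set of $K_n$. "$G_{n,p}$ contains the square of a Hamilton cycle" means some such graph is a subgraph of $G_{n,p}$. *)

theory Defs
  imports "HOL-Probability.Probability" "HOL-Library.Extended_Nat"
begin

text \<open>Simple graphs: an edge is a two-element set of vertices.\<close>

datatype 'a graph = Graph (verts: "'a set") (edges: "'a set set")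

definition all_edges :: "'a set \<Rightarrow> 'a set set" where
  "all_edges V = {e. e \<subseteq> V \<and> card e = 2}"

definition subgraph :: "'a graph \<Rightarrow> 'a graph \<Rightarrow> bool" where
  "subgraph H G \<longleftrightarrow> verts H \<subseteq> verts G \<and> edges H \<subseteq> edges G"

definition is_walk :: "'a graph \<Rightarrow> 'a list \<Rightarrow> bool" where
  "is_walk G xs \<longleftrightarrow> xs \<noteq> [] \<and> set xs \<subseteq> verts G \<and>
     (\<forall>i. Suc i < length xs \<longrightarrow> {xs ! i, xs ! Suc i} \<in> edges G)"

text \<open>The distance is \<open>\<infinity>\<close> if no walk joins the two vertices, since the infimum of the
  empty set in \<^typ>\<open>enat\<close> is \<open>\<infinity>\<close>.\<close>

definition graph_dist :: "'a graph \<Rightarrow> 'a \<Rightarrow> 'a \<Rightarrow> enat" where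
  "graph_dist G u v =
     Inf {enat (length xs - 1) | xs. is_walk G xs \<and> hd xs = u \<and> last xs = v}"

definition graph_square :: "'a graph \<Rightarrow> 'a graph" where
  "graph_square G = Graph (verts G)
     {{u, v} | u v. u \<in> verts G \<and> v \<in> verts G \<and> u \<noteq> v \<and> graph_dist G u v \<le> 2}"

definition is_cycle :: "'a graph \<Rightarrow> bool" where
  "is_cycle C \<longleftrightarrow> card (verts C) \<ge> 3 \<and>
     (\<exists>c. bij_betw c {..<card (verts C)} (verts C) \<and>
          edges C = {{c i, c (Suc i mod card (verts C))} | i. i < card (verts C)})"

definition contains_ham_cycle_square :: "'a graph \<Rightarrow> bool" where
  "contains_ham_cycle_square G \<longleftrightarrow>
     (\<exists>C. is_cycle C \<and> verts C = verts G \<and> subgraph (graph_square C) G)"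

text \<open>The binomial random graph; meaningful for \<open>0 \<le> p \<le> 1\<close>, as \<^const>\<open>bernoulli_pmf\<close>
  truncates its parameter to that interval.\<close>

definition gnp :: "nat \<Rightarrow> real \<Rightarrow> nat graph pmf" where
  "gnp n p = map_pmf (\<lambda>f. Graph {1..n} {e \<in> all_edges {1..n}. f e})
     (Pi_pmf (all_edges {1..n}) False (\<lambda>_. bernoulli_pmf p))"

end

theory Submission
  imports Defs "HOL-Combinatorics.Permutations" "HOL-Real_Asymp.Real_Asymp"
begin

text \<open>
  The argument of Kahn, Narayanan and Park, with minimum fragments. Copies of the squared cycle are
  indexed by permutations, and the random graph is the union of two independent ones, with edge
  probabilities of order \<open>1 / sqrt n\<close>. For a copy \<open>S\<close> and the first random graph \<open>W\<close>, the fragment of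
  \<open>S\<close> is the smallest \<open>S' - W\<close> with \<open>S'\<close> a copy inside \<open>S \<union> W\<close>. A set \<open>J\<close> of edges of a copy that
  splits into \<open>c\<close> runs lies in a proportion of at most \<open>O(1) ^ |J| * n powr (- (|J| + c) / 2)\<close> of all
  copies, and summing this over \<open>J\<close> shows that most fragments have at most \<open>sqrt n\<close> edges. The same sum
  over the subsets of a fixed fragment of that size is bounded, so a second moment computation
  shows that the second random graph is likely to contain one of the fragments.
\<close>

section \<open>Binomial random subsets\<close>

text \<open>The size \<open>sqrt n\<close> comes from this count. A set \<open>J\<close> of
  non-wrapping edges with \<open>c\<close> runs contains a forest with at least
  \<open>(|J| + c) / 2\<close> edges, and each forest edge costs a factor of order
  \<open>1 / n\<close> in the proportion of copies containing \<open>J\<close>. Dividing by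
  \<open>p ^ |J|\<close> with \<open>p\<close> of order \<open>1 / sqrt n\<close> leaves
  \<open>n powr (- c / 2)\<close> times a constant to the power \<open>|J|\<close>. Powers of
  \<open>n\<close> are thus paid per run only, and if that constant is small, the sum over all
  subsets of \<open>T\<close> is at most the exponential of a multiple of
  \<open>|T| / sqrt n\<close>. This is bounded for \<open>|T| \<le> sqrt n\<close> but not for a
  whole copy, so the second moment is computed for fragments. In the first round the exponential is
  beaten by the factor \<open>(1 / 2) ^ k\<close> that comes from having at least \<open>k\<close>
  edges.

  Runs follow the linear order of the edge numbers, which does not suit the three edges wrapping
  around. Losing \<open>n ^ 3\<close> for them is harmless next to an exponentially small bound, but
  not in the second round, where the second moment ratio must be close to 1. There the cycle is cut
  open where the small fragment misses it.\<close>

definition bern_exp :: "real \<Rightarrow> 'a set \<Rightarrow> ('a set \<Rightarrow> real) \<Rightarrow> real" where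
  "bern_exp p X f = (\<Sum>W\<in>Pow X. p ^ card W * (1 - p) ^ card (X - W) * f W)"

lemma bern_exp_cong: "(\<And>W. W \<subseteq> X \<Longrightarrow> f W = g W) \<Longrightarrow> bern_exp p X f = bern_exp p X g"
  unfolding bern_exp_def by (intro sum.cong) auto

lemma bern_exp_mono:
  assumes "0 \<le> p" "p \<le> 1" "\<And>W. W \<subseteq> X \<Longrightarrow> f W \<le> g W"
  shows "bern_exp p X f \<le> bern_exp p X g"
  unfolding bern_exp_def by (intro sum_mono mult_left_mono) (use assms in auto)

lemma bern_exp_add: "bern_exp p X (\<lambda>W. f W + g W) = bern_exp p X f + bern_exp p X g"
  by (simp add: bern_exp_def ring_distribs sum.distrib)

lemma bern_exp_diff: "bern_exp p X (\<lambda>W. f W - g W) = bern_exp p X f - bern_exp p X g"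
  by (simp add: bern_exp_def right_diff_distrib sum_subtractf)

lemma bern_exp_cmult: "bern_exp p X (\<lambda>W. c * f W) = c * bern_exp p X f"
  by (simp add: bern_exp_def sum_distrib_left mult_ac)

lemma bern_exp_sum: "bern_exp p X (\<lambda>W. \<Sum>i\<in>I. f i W) = (\<Sum>i\<in>I. bern_exp p X (f i))"
  unfolding bern_exp_def by (subst sum.swap) (simp add: sum_distrib_left)

lemma bern_exp_empty [simp]: "bern_exp p {} f = f {}"
  by (simp add: bern_exp_def)

lemma bern_exp_insert:
  assumes "finite X" "x \<notin> X"
  shows "bern_exp p (insert x X) f =
    p * bern_exp p X (\<lambda>W. f (insert x W)) + (1 - p) * bern_exp p X f"
proof -
  have inj: "inj_on (insert x) (Pow X)"
    using assms(2) by (auto simp: inj_on_def)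
  have 1: "insert x X - insert x W = X - W" if "W \<subseteq> X" for W
    using assms(2) that by auto
  have 2: "insert x X - W = insert x (X - W)" if "W \<subseteq> X" for W
    using assms(2) that by auto
  have fin: "finite W" if "W \<subseteq> X" for W using that assms(1) finite_subset by blast
  have 3: "card (insert x W) = Suc (card W)" if "W \<subseteq> X" for W
    using assms that fin by (subst card_insert_disjoint) auto
  have 4: "card (insert x (X - W)) = Suc (card (X - W))" for W
    using assms by (subst card_insert_disjoint) auto
  have "bern_exp p (insert x X) f =
    (\<Sum>W\<in>Pow X. p ^ card W * (1 - p) ^ card (insert x X - W) * f W) +
    (\<Sum>W\<in>insert x ` Pow X. p ^ card W * (1 - p) ^ card (insert x X - W) * f W)"
    unfolding bern_exp_def Pow_insert using assms by (intro sum.union_disjoint) auto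
  also have "(\<Sum>W\<in>insert x ` Pow X. p ^ card W * (1 - p) ^ card (insert x X - W) * f W)
     = p * bern_exp p X (\<lambda>W. f (insert x W))"
    unfolding bern_exp_def sum_distrib_left
    unfolding sum.reindex[OF inj] o_def
  proof (intro sum.cong refl)
    fix W assume "W \<in> Pow X"
    then have W: "W \<subseteq> X" by simp
    show "p ^ card (insert x W) * (1 - p) ^ card (insert x X - insert x W) * f (insert x W) =
        p * (p ^ card W * (1 - p) ^ card (X - W) * f (insert x W))"
      by (simp only: 1[OF W] 3[OF W] power_Suc mult.assoc)
  qed
  also have "(\<Sum>W\<in>Pow X. p ^ card W * (1 - p) ^ card (insert x X - W) * f W) =
      (1 - p) * bern_exp p X f"
    unfolding bern_exp_def sum_distrib_left
  proof (intro sum.cong refl)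
    fix W assume "W \<in> Pow X"
    then have W: "W \<subseteq> X" by simp
    show "p ^ card W * (1 - p) ^ card (insert x X - W) * f W =
        (1 - p) * (p ^ card W * (1 - p) ^ card (X - W) * f W)"
      by (simp only: 2[OF W] 4 power_Suc mult_ac)
  qed
  finally show ?thesis by simp
qed

lemma bern_exp_const [simp]: "finite X \<Longrightarrow> bern_exp p X (\<lambda>_. c) = c"
  by (induction X rule: finite_induct) (auto simp: bern_exp_insert algebra_simps)

text \<open>An element is absent from the union of two independent random sets iff both miss it,
  which happens with probability \<open>(1 - p1) * (1 - p2)\<close>. The induction exposes one
  element at a time.\<close>

lemma bern_exp_Un:
  assumes "finite X" "1 - p = (1 - p1) * (1 - p2)"
  shows "bern_exp p X f = bern_exp p1 X (\<lambda>W. bern_exp p2 X (\<lambda>W'. f (W \<union> W')))"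
  using assms(1)
proof (induction X arbitrary: f rule: finite_induct)
  case (insert x X)
  define a where "a = bern_exp p X (\<lambda>W. f (insert x W))"
  define b where "b = bern_exp p X f"
  have "bern_exp p1 (insert x X) (\<lambda>W. bern_exp p2 (insert x X) (\<lambda>W'. f (W \<union> W'))) =
      p1 * (p2 * a + (1 - p2) * a) + (1 - p1) * (p2 * a + (1 - p2) * b)"
    using insert.hyps
    by (simp add: bern_exp_insert bern_exp_add bern_exp_cmult a_def b_def insert.IH)
      (simp add: algebra_simps)
  also have "\<dots> = p * a + (1 - p) * b"
    using assms(2) by algebra
  also have "\<dots> = bern_exp p (insert x X) f"
    using insert.hyps by (simp add: bern_exp_insert a_def b_def)
  finally show ?case by simp
qed simp

lemma bern_exp_superset:
  assumes "finite X" "T \<subseteq> X"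
  shows "bern_exp p X (\<lambda>W. of_bool (T \<subseteq> W)) = p ^ card T"
  using assms
proof (induction X arbitrary: T rule: finite_induct)
  case (insert x X)
  show ?case
  proof (cases "x \<in> T")
    case True
    have "bern_exp p X (\<lambda>W. of_bool (T \<subseteq> insert x W)) =
        bern_exp p X (\<lambda>W. of_bool (T - {x} \<subseteq> W))"
      by (intro bern_exp_cong arg_cong[where f = of_bool]) auto
    also have "\<dots> = p ^ card (T - {x})"
      using insert.prems by (intro insert.IH) auto
    finally have 1: "bern_exp p X (\<lambda>W. of_bool (T \<subseteq> insert x W)) = p ^ card (T - {x})" .
    have 2: "bern_exp p X (\<lambda>W. of_bool (T \<subseteq> W)) = bern_exp p X (\<lambda>_. 0)"
      using True insert.hyps by (intro bern_exp_cong) auto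
    have "finite T" using insert.prems insert.hyps finite_subset by blast
    with True have "card T = Suc (card (T - {x}))" by (simp only: card_Suc_Diff1)
    then show ?thesis using insert.hyps by (simp add: bern_exp_insert 1 2)
  next
    case False
    then have *: "T \<subseteq> X" using insert.prems by auto
    have "T \<subseteq> insert x W \<longleftrightarrow> T \<subseteq> W" for W using False by auto
    then show ?thesis using insert.hyps insert.IH[OF *]
      by (simp add: bern_exp_insert algebra_simps)
  qed
qed simp

text \<open>The only link between the product measure and the finite sums \<open>bern_exp\<close>.
  The default value \<open>False\<close> confines the support to indicator functions of subsets of
  \<open>X\<close>.\<close>

lemma prob_Pi_pmf_bernoulli:
  assumes "finite X" "0 \<le> p" "p \<le> 1"
  shows "measure_pmf.prob (Pi_pmf X False (\<lambda>_. bernoulli_pmf p)) {f. Q {e \<in> X. f e}} =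
    bern_exp p X (\<lambda>W. of_bool (Q W))"
proof -
  let ?M = "Pi_pmf X False (\<lambda>_. bernoulli_pmf p)"
  let ?B = "(\<lambda>W e. e \<in> W) ` Pow X"
  have sub: "set_pmf ?M \<subseteq> ?B"
  proof
    fix f assume "f \<in> set_pmf ?M"
    then have "\<forall>e. e \<notin> X \<longrightarrow> f e = False"
      using set_Pi_pmf_subset[OF assms(1), of False "\<lambda>_. bernoulli_pmf p"] by blast
    then show "f \<in> ?B" by (intro image_eqI[of _ _ "{e. f e}"]) auto
  qed
  have finB: "finite ?B" using assms(1) by auto
  have inj: "inj_on (\<lambda>W e. e \<in> W) (Pow X)"
    by (auto simp: inj_on_def fun_eq_iff)
  have pmf: "pmf ?M (\<lambda>e. e \<in> W) = p ^ card W * (1 - p) ^ card (X - W)" if W: "W \<subseteq> X" for W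
  proof -
    have "pmf ?M (\<lambda>e. e \<in> W) = (\<Prod>e\<in>X. pmf (bernoulli_pmf p) (e \<in> W))"
      using W by (intro pmf_Pi' assms(1)) auto
    also have "\<dots> = (\<Prod>e\<in>X. if e \<in> W then p else 1 - p)"
      using assms by (intro prod.cong) auto
    also have "\<dots> = p ^ card (X \<inter> W) * (1 - p) ^ card (X \<inter> - W)"
      using assms(1) by (subst prod.If_cases) auto
    also have "X \<inter> W = W" using W by auto
    also have "X \<inter> - W = X - W" by auto
    finally show ?thesis .
  qed
  have "measure_pmf.prob ?M {f. Q {e \<in> X. f e}} =
      measure_pmf.prob ?M ({f. Q {e \<in> X. f e}} \<inter> ?B)"
  proof -
    let ?A = "{f. Q {e \<in> X. f e}}"
    have "measure_pmf.prob ?M ?A = measure_pmf.prob ?M (?A \<inter> set_pmf ?M)"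
      by (rule measure_Int_set_pmf[symmetric])
    also have "?A \<inter> set_pmf ?M = ?A \<inter> ?B \<inter> set_pmf ?M" using sub by blast
    also have "measure_pmf.prob ?M (?A \<inter> ?B \<inter> set_pmf ?M) = measure_pmf.prob ?M (?A \<inter> ?B)"
      by (rule measure_Int_set_pmf)
    finally show ?thesis .
  qed
  also have "\<dots> = (\<Sum>f\<in>{f. Q {e \<in> X. f e}} \<inter> ?B. pmf ?M f)"
    using finB by (intro measure_measure_pmf_finite) auto
  also have "\<dots> = (\<Sum>f\<in>?B. pmf ?M f * of_bool (Q {e \<in> X. f e}))"
    using finB by (intro sum.mono_neutral_cong_left) auto
  also have "\<dots> = (\<Sum>W\<in>Pow X. pmf ?M (\<lambda>e. e \<in> W) * of_bool (Q {e \<in> X. e \<in> W}))"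
    by (subst sum.reindex[OF inj]) (simp add: o_def)
  also have "\<dots> = bern_exp p X (\<lambda>W. of_bool (Q W))"
    unfolding bern_exp_def
  proof (intro sum.cong refl)
    fix W assume "W \<in> Pow X"
    then have "W \<subseteq> X" "{e \<in> X. e \<in> W} = W" by auto
    then show "pmf ?M (\<lambda>e. e \<in> W) * of_bool (Q {e \<in> X. e \<in> W}) =
        p ^ card W * (1 - p) ^ card (X - W) * of_bool (Q W)"
      by (simp only: pmf)
  qed
  finally show ?thesis .
qed

text \<open>Chebyshev's inequality for \<open>Y\<close>, which counts the \<open>T i\<close> inside
  \<open>W\<close>, each weighted to have mean 1. The double sum in \<open>corr\<close> is the
  second moment of \<open>Y\<close>, and where no \<open>T i\<close> lies in \<open>W\<close>, the
  deviation \<open>(Y W - N)\<^sup>2\<close> equals \<open>N\<^sup>2\<close>.\<close>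

lemma bern_exp_second_moment:
  assumes X: "finite X" "0 < p" "p \<le> 1" and G: "finite G" "G \<noteq> {}"
    and T: "\<And>i. i \<in> G \<Longrightarrow> T i \<subseteq> X"
    and corr: "(\<Sum>i\<in>G. \<Sum>j\<in>G. (1 / p) ^ card (T i \<inter> T j)) \<le> (1 + \<delta>) * (real (card G))\<^sup>2"
  shows "1 - \<delta> \<le> bern_exp p X (\<lambda>W. of_bool (\<exists>i\<in>G. T i \<subseteq> W))"
proof -
  define N where "N = real (card G)"
  define y where "y = (\<lambda>i W. (1 / p) ^ card (T i) * of_bool (T i \<subseteq> W))"
  define Y where "Y = (\<lambda>W. \<Sum>i\<in>G. y i W)"
  define ind where "ind = (\<lambda>W. of_bool (\<exists>i\<in>G. T i \<subseteq> W) :: real)"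
  have N: "N > 0" using G by (simp add: N_def card_gt_0_iff)
  have finT: "finite (T i)" if "i \<in> G" for i using T[OF that] X(1) finite_subset by blast
  have EY: "bern_exp p X Y = N"
  proof -
    have "bern_exp p X (y i) = 1" if "i \<in> G" for i
      unfolding y_def bern_exp_cmult using X T[OF that]
      by (simp add: bern_exp_superset power_one_over)
    then show ?thesis by (simp add: Y_def bern_exp_sum N_def)
  qed
  have Eyy: "bern_exp p X (\<lambda>W. y i W * y j W) = (1 / p) ^ card (T i \<inter> T j)"
    if "i \<in> G" "j \<in> G" for i j
  proof -
    have "bern_exp p X (\<lambda>W. y i W * y j W) =
      bern_exp p X (\<lambda>W. ((1 / p) ^ card (T i) * (1 / p) ^ card (T j)) * of_bool (T i \<union> T j \<subseteq> W))"
      by (intro bern_exp_cong) (auto simp: y_def)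
    also have "\<dots> = (1 / p) ^ (card (T i) + card (T j)) * p ^ card (T i \<union> T j)"
      using that T X by (simp only: bern_exp_cmult bern_exp_superset Un_least power_add)
    also have "card (T i) + card (T j) = card (T i \<inter> T j) + card (T i \<union> T j)"
      using card_Un_Int[OF finT[OF that(1)] finT[OF that(2)]] by simp
    also have "(1 / p) ^ (card (T i \<inter> T j) + card (T i \<union> T j)) * p ^ card (T i \<union> T j) =
        (1 / p) ^ card (T i \<inter> T j)"
      using X by (simp add: power_add power_one_over)
    finally show ?thesis .
  qed
  have EYY: "bern_exp p X (\<lambda>W. Y W * Y W) \<le> (1 + \<delta>) * N\<^sup>2"
  proof -
    have "bern_exp p X (\<lambda>W. Y W * Y W) = (\<Sum>i\<in>G. \<Sum>j\<in>G. (1 / p) ^ card (T i \<inter> T j))"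
      unfolding Y_def sum_product bern_exp_sum using Eyy by (intro sum.cong) auto
    then show ?thesis using corr by (simp add: N_def)
  qed
  have "bern_exp p X (\<lambda>W. N\<^sup>2 * (1 - ind W)) \<le> bern_exp p X (\<lambda>W. Y W * Y W - 2 * N * Y W + N\<^sup>2)"
  proof (intro bern_exp_mono)
    fix W
    show "N\<^sup>2 * (1 - ind W) \<le> Y W * Y W - 2 * N * Y W + N\<^sup>2"
    proof (cases "\<exists>i\<in>G. T i \<subseteq> W")
      case True
      have "0 \<le> (Y W - N)\<^sup>2" by simp
      also have "\<dots> = Y W * Y W - 2 * N * Y W + N\<^sup>2" by (simp add: power2_eq_square algebra_simps)
      finally show ?thesis using True by (simp add: ind_def)
    next
      case False
      then have "Y W = 0" by (auto simp: Y_def y_def intro!: sum.neutral)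
      then show ?thesis using False by (simp add: ind_def)
    qed
  qed (use X in auto)
  also have "\<dots> = bern_exp p X (\<lambda>W. Y W * Y W) - N\<^sup>2"
    using X(1) by (simp add: bern_exp_add bern_exp_diff bern_exp_cmult EY power2_eq_square mult.assoc)
  also have "\<dots> \<le> N\<^sup>2 * \<delta>" using EYY by (simp add: algebra_simps)
  finally have "N\<^sup>2 * (1 - bern_exp p X ind) \<le> N\<^sup>2 * \<delta>"
    using X(1) by (simp add: bern_exp_diff bern_exp_cmult)
  then have "1 - bern_exp p X ind \<le> \<delta>" using N by simp
  then show ?thesis by (simp add: ind_def)
qed

section \<open>Minimum fragments\<close>

definition fragment :: "('i \<Rightarrow> 'a set) \<Rightarrow> 'i set \<Rightarrow> 'i \<Rightarrow> 'a set \<Rightarrow> 'a set" where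
  "fragment S I i W = arg_min card (\<lambda>T. \<exists>j\<in>I. S j \<subseteq> S i \<union> W \<and> T = S j - W)"

text \<open>The choice \<open>j = i\<close> is always admissible, so the minimum is attained. Every
  set competing for it is contained in \<open>S i\<close>.\<close>

lemma fragment_props:
  assumes "i \<in> I"
  shows "fragment S I i W \<subseteq> S i" "fragment S I i W \<inter> W = {}"
    "\<exists>j\<in>I. S j \<subseteq> fragment S I i W \<union> W"
    "\<And>j. j \<in> I \<Longrightarrow> S j \<subseteq> S i \<union> W \<Longrightarrow> card (fragment S I i W) \<le> card (S j - W)"
proof -
  let ?P = "\<lambda>T. \<exists>j\<in>I. S j \<subseteq> S i \<union> W \<and> T = S j - W"
  have "?P (S i - W)" using assms by blast
  from arg_min_nat_lemma[of ?P, OF this, of card]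
  have *: "?P (fragment S I i W)" and min: "\<And>T. ?P T \<Longrightarrow> card (fragment S I i W) \<le> card T"
    unfolding fragment_def by blast+
  from * obtain j where j: "j \<in> I" "S j \<subseteq> S i \<union> W" "fragment S I i W = S j - W" by blast
  show "fragment S I i W \<subseteq> S i" "fragment S I i W \<inter> W = {}" using j by auto
  show "\<exists>j\<in>I. S j \<subseteq> fragment S I i W \<union> W" using j by auto
  show "card (fragment S I i W) \<le> card (S j - W)" if "j \<in> I" "S j \<subseteq> S i \<union> W" for j
    using min that by blast
qed

text \<open>Given \<open>Z = W \<union> T\<close> with \<open>T\<close> the fragment of \<open>(i, W)\<close>, every \<open>S j \<subseteq> Z\<close> contains \<open>T\<close> by
  minimality. So \<open>T\<close> is one of the subsets of a single set chosen as a function of \<open>Z\<close>, and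
  passing from \<open>W\<close> to \<open>Z\<close> costs a factor of at most \<open>(1 / p) ^ card T\<close>.\<close>

lemma bern_exp_large_fragments:
  assumes X: "finite X" "0 < p" "p \<le> 1" and I: "finite I"
    and S: "\<And>i. i \<in> I \<Longrightarrow> S i \<subseteq> X"
    and B: "\<And>j. j \<in> I \<Longrightarrow>
      (\<Sum>T | T \<subseteq> S j \<and> k \<le> card T. (1 / p) ^ card T * card {i \<in> I. T \<subseteq> S i}) \<le> B" and "0 \<le> B"
  shows "bern_exp p X (\<lambda>W. card {i \<in> I. k \<le> card (fragment S I i W)}) \<le> B"
proof -
  define wt where "wt = (\<lambda>W. p ^ card W * (1 - p) ^ card (X - W))"
  define rep where "rep = (\<lambda>Z. SOME j. j \<in> I \<and> S j \<subseteq> Z)"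
  define U where "U = {Z. Z \<subseteq> X \<and> (\<exists>j\<in>I. S j \<subseteq> Z)}"
  define C where "C = (\<lambda>Z. {T. T \<subseteq> S (rep Z) \<and> k \<le> card T})"
  define D where "D = (\<lambda>T. {i \<in> I. T \<subseteq> S i})"
  have finX: "finite W" if "W \<subseteq> X" for W using X(1) that finite_subset by blast
  have rep: "rep Z \<in> I" "S (rep Z) \<subseteq> Z" if "Z \<in> U" for Z
  proof -
    have "\<exists>j. j \<in> I \<and> S j \<subseteq> Z" using that by (auto simp: U_def)
    then have "rep Z \<in> I \<and> S (rep Z) \<subseteq> Z" unfolding rep_def by (rule someI_ex)
    then show "rep Z \<in> I" "S (rep Z) \<subseteq> Z" by auto
  qed
  have finU: "finite U" using X(1) by (simp add: U_def)
  have finC: "finite (C Z)" if "Z \<in> U" for Z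
    using finX[OF S[OF rep(1)[OF that]]] by (simp add: C_def)
  have finD: "finite (D T)" for T using I by (simp add: D_def)
  have wt0: "wt W \<ge> 0" for W using X by (simp add: wt_def)
  have "bern_exp p X (\<lambda>W. card {i \<in> I. k \<le> card (fragment S I i W)}) =
      (\<Sum>W\<in>Pow X. \<Sum>i | i \<in> I \<and> k \<le> card (fragment S I i W). wt W)"
    by (simp add: bern_exp_def wt_def mult_ac)
  also have "\<dots> = (\<Sum>(W, i)\<in>(SIGMA W:Pow X. {i \<in> I. k \<le> card (fragment S I i W)}). wt W)"
    using X(1) I by (subst sum.Sigma) auto
  \<comment> \<open>Each bad pair \<open>(W, i)\<close> is charged to the triple
    \<open>(Z, T, i)\<close> with \<open>Z = W \<union> T\<close>. As the fragment \<open>T\<close>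
    is disjoint from \<open>W\<close>, the set \<open>W\<close> is recovered as
    \<open>Z - T\<close>.\<close>
  also have "\<dots> \<le> (\<Sum>(Z, T, i)\<in>(SIGMA Z:U. SIGMA T:C Z. D T). wt Z * (1 / p) ^ card T)"
  proof (rule sum_le_included[where i = "\<lambda>(Z, T, i). (Z - T, i)"])
    show "finite (SIGMA W:Pow X. {i \<in> I. k \<le> card (fragment S I i W)})"
      using X(1) I by (intro finite_SigmaI) auto
    show "finite (SIGMA Z:U. SIGMA T:C Z. D T)"
      using finU finC finD by (intro finite_SigmaI) auto
    show "\<forall>y\<in>(SIGMA Z:U. SIGMA T:C Z. D T). 0 \<le> (case y of (Z, T, i) \<Rightarrow> wt Z * (1 / p) ^ card T)"
      using wt0 X by auto
    show "\<forall>x\<in>(SIGMA W:Pow X. {i \<in> I. k \<le> card (fragment S I i W)}).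
      \<exists>y\<in>(SIGMA Z:U. SIGMA T:C Z. D T). (\<lambda>(Z, T, i). (Z - T, i)) y = x \<and>
         (case x of (W, i) \<Rightarrow> wt W) \<le> (case y of (Z, T, i) \<Rightarrow> wt Z * (1 / p) ^ card T)"
    proof (clarify)
      fix W i assume W: "W \<subseteq> X" and i: "i \<in> I" and k: "k \<le> card (fragment S I i W)"
      define T where "T = fragment S I i W"
      note fr = fragment_props[OF i, where S = S and W = W, folded T_def]
      define Z where "Z = W \<union> T"
      have TX: "T \<subseteq> X" using fr(1) S[OF i] by blast
      have Z: "Z \<in> U" using fr(3) W TX by (auto simp: U_def Z_def)
      have "S (rep Z) \<subseteq> W \<union> T" using rep(2)[OF Z] by (simp add: Z_def)
      then have "S (rep Z) - W \<subseteq> T" "S (rep Z) \<subseteq> S i \<union> W" using fr(1) by auto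
      moreover from this(2) have "card T \<le> card (S (rep Z) - W)" using fr(4) rep(1)[OF Z] by blast
      ultimately have "S (rep Z) - W = T" by (intro card_seteq finX TX)
      then have TC: "T \<in> C Z" using k by (auto simp: C_def T_def)
      have iD: "i \<in> D T" using i fr(1) by (simp add: D_def)
      have ZT: "Z - T = W" using fr(2) by (auto simp: Z_def)
      have "card Z = card W + card T"
        unfolding Z_def using fr(2) by (intro card_Un_disjoint finX W TX) auto
      moreover have "card (X - Z) \<le> card (X - W)" using X(1) by (intro card_mono) (auto simp: Z_def)
      then have "(1 - p) ^ card (X - W) \<le> (1 - p) ^ card (X - Z)"
        using X by (intro power_decreasing) auto
      ultimately have "wt W \<le> wt Z * (1 / p) ^ card T"
        unfolding wt_def using X by (simp add: power_add power_one_over mult_left_mono)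
      then show "\<exists>y\<in>(SIGMA Z:U. SIGMA T:C Z. D T). (\<lambda>(Z, T, i). (Z - T, i)) y = (W, i) \<and>
         wt W \<le> (case y of (Z, T, i) \<Rightarrow> wt Z * (1 / p) ^ card T)"
        using Z TC iD ZT by (intro bexI[of _ "(Z, T, i)"]) auto
    qed
  qed
  also have "\<dots> = (\<Sum>Z\<in>U. \<Sum>T\<in>C Z. \<Sum>i\<in>D T. wt Z * (1 / p) ^ card T)"
  proof -
    have "(\<Sum>Z\<in>U. \<Sum>T\<in>C Z. \<Sum>i\<in>D T. wt Z * (1 / p) ^ card T) =
        (\<Sum>Z\<in>U. \<Sum>(T, i)\<in>(SIGMA T:C Z. D T). wt Z * (1 / p) ^ card T)"
      using finC finD by (intro sum.cong refl sum.Sigma) auto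
    also have "\<dots> = (\<Sum>(Z, T, i)\<in>(SIGMA Z:U. SIGMA T:C Z. D T). wt Z * (1 / p) ^ card T)"
      using finU finC finD by (subst sum.Sigma) (auto simp: case_prod_unfold)
    finally show ?thesis by simp
  qed
  also have "\<dots> = (\<Sum>Z\<in>U. wt Z * (\<Sum>T\<in>C Z. (1 / p) ^ card T * card (D T)))"
    by (simp add: sum_distrib_left mult_ac)
  also have "\<dots> \<le> (\<Sum>Z\<in>U. wt Z * B)"
    using B rep(1) wt0 unfolding C_def D_def by (intro sum_mono mult_left_mono) auto
  also have "\<dots> \<le> (\<Sum>Z\<in>Pow X. wt Z * B)"
    using X(1) wt0 \<open>0 \<le> B\<close> by (intro sum_mono2) (auto simp: U_def)
  also have "\<dots> = bern_exp p X (\<lambda>_. B)" by (simp add: bern_exp_def wt_def)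
  also have "\<dots> = B" using X by simp
  finally show ?thesis .
qed

section \<open>Runs of integers\<close>

text \<open>A run is a maximal subset of \<open>J\<close> with gaps at most 3. The constant fits the numbering of the edges
  of the squared cycle below: the edges from \<open>j - 1\<close> and \<open>j\<close> backwards have numbers \<open>2 * j - 2\<close>
  to \<open>2 * j + 1\<close>.\<close>

definition run_starts :: "nat set \<Rightarrow> nat set" where
  "run_starts J = {a \<in> J. \<forall>b\<in>J. b < a \<longrightarrow> b + 3 < a}"

text \<open>With \<open>l\<close> and \<open>m\<close> both of order \<open>1 / sqrt n\<close> this
  is the bound on the proportion of copies containing \<open>J\<close>. Multiplying by
  \<open>(1 / p) ^ card J\<close> turns \<open>l\<close> into a constant and leaves
  \<open>m\<close>, the price of a run, as it is.\<close>

definition run_weight :: "real \<Rightarrow> real \<Rightarrow> nat set \<Rightarrow> real" where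
  "run_weight l m J = l ^ card J * m ^ card (run_starts J)"

lemma run_starts_subset: "run_starts J \<subseteq> J"
  by (auto simp: run_starts_def)

lemma run_weight_empty [simp]: "run_weight l m {} = 1"
  by (simp add: run_weight_def run_starts_def)

lemma run_weight_nonneg: "0 \<le> l \<Longrightarrow> 0 \<le> m \<Longrightarrow> 0 \<le> run_weight l m J"
  by (simp add: run_weight_def)

text \<open>Being a start depends on smaller elements only, so an element inserted above all of
  \<open>J\<close> leaves the other starts alone.\<close>

lemma run_weight_insert:
  assumes "J \<subseteq> {..<a}"
  shows "run_weight l m (insert a J) =
    (if \<forall>b\<in>J. b + 3 < a then l * m * run_weight l m J else l * run_weight l m J)"
proof -
  have fin: "finite J" using assms finite_subset by blast
  have a: "a \<notin> J" "a \<notin> run_starts J" using assms run_starts_subset[of J] by auto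
  have "run_starts (insert a J) =
    (if \<forall>b\<in>J. b + 3 < a then insert a (run_starts J) else run_starts J)"
    using assms by (auto simp: run_starts_def)
  moreover have "finite (run_starts J)" using fin run_starts_subset finite_subset by blast
  ultimately show ?thesis using a fin by (simp add: run_weight_def)
qed

text \<open>If \<open>a\<close> does not start a run, the largest element below \<open>a\<close> is one of \<open>a - 3\<close>, \<open>a - 2\<close>, \<open>a - 1\<close>,
  and the bound for these three applies.\<close>

lemma sum_run_weight_insert_le:
  assumes "0 \<le> l" "6 * l \<le> 1" "0 \<le> m"
  shows "(\<Sum>J\<in>Pow (T \<inter> {..<a}). run_weight l m (insert a J)) \<le>
    2 * l * m * (\<Sum>J\<in>Pow (T \<inter> {..<a}). run_weight l m J)"
proof (induction a rule: less_induct)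
  case (less a)
  define w where "w = run_weight l m"
  define P where "P = (\<lambda>a. Pow (T \<inter> {..<a}))"
  define A where "A = sum w (P a)"
  have w0: "w J \<ge> 0" for J unfolding w_def using assms run_weight_nonneg by blast
  have finP: "finite (P b)" for b by (simp add: P_def)
  have A0: "A \<ge> 0" unfolding A_def by (intro sum_nonneg w0)
  define N where "N = {J \<in> P a. \<not> (\<forall>b\<in>J. b + 3 < a)}"
  have N: "sum w N \<le> 3 * (2 * l * m * A)"
  proof -
    have "sum w N \<le> (\<Sum>(c, J)\<in>(SIGMA c:{a - 3..<a}. P c). w (insert c J))"
    proof (rule sum_le_included[where i = "\<lambda>(c, J). insert c J"])
      show "finite N" using finP by (simp add: N_def)
      show "finite (SIGMA c:{a - 3..<a}. P c)" using finP by auto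
      show "\<forall>y\<in>(SIGMA c:{a - 3..<a}. P c). 0 \<le> (case y of (c, J) \<Rightarrow> w (insert c J))"
        using w0 by auto
      show "\<forall>x\<in>N. \<exists>y\<in>(SIGMA c:{a - 3..<a}. P c). (case y of (c, J) \<Rightarrow> insert c J) = x \<and>
          w x \<le> (case y of (c, J) \<Rightarrow> w (insert c J))"
      proof
        fix J assume J: "J \<in> N"
        then have J': "J \<subseteq> T" "J \<subseteq> {..<a}" by (auto simp: N_def P_def)
        then have fin: "finite J" using finite_subset by blast
        from J obtain b where b: "b \<in> J" "a \<le> b + 3" by (auto simp: N_def)
        define c where "c = Max J"
        have c: "c \<in> J" unfolding c_def using fin b by (intro Max_in) auto
        have max: "x \<le> c" if "x \<in> J" for x using fin that by (simp add: c_def)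
        have "J - {c} \<in> P c" using J' max by (fastforce simp: P_def less_le)
        moreover have "c \<in> {a - 3..<a}" using max[OF b(1)] b(2) c J' by auto
        moreover have "insert c (J - {c}) = J" using c by auto
        ultimately show "\<exists>y\<in>(SIGMA c:{a - 3..<a}. P c). (case y of (c, J) \<Rightarrow> insert c J) = J \<and>
          w J \<le> (case y of (c, J) \<Rightarrow> w (insert c J))"
          by (intro bexI[of _ "(c, J - {c})"]) auto
      qed
    qed
    also have "\<dots> = (\<Sum>c\<in>{a - 3..<a}. \<Sum>J\<in>P c. w (insert c J))"
      using finP by (subst sum.Sigma) auto
    also have "\<dots> \<le> (\<Sum>c\<in>{a - 3..<a}. 2 * l * m * A)"
    proof (rule sum_mono)
      fix c assume "c \<in> {a - 3..<a}"
      then have c: "c < a" by simp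
      have "(\<Sum>J\<in>P c. w (insert c J)) \<le> 2 * l * m * sum w (P c)"
        using less[OF c] by (simp add: w_def P_def)
      also have "\<dots> \<le> 2 * l * m * A"
        unfolding A_def using assms c finP w0
        by (intro mult_left_mono sum_mono2) (auto simp: P_def)
      finally show "(\<Sum>J\<in>P c. w (insert c J)) \<le> 2 * l * m * A" .
    qed
    also have "\<dots> = real (a - (a - 3)) * (2 * l * m * A)" by simp
    also have "\<dots> \<le> 3 * (2 * l * m * A)"
      using assms A0 by (intro mult_right_mono) auto
    finally show ?thesis .
  qed
  have "(\<Sum>J\<in>P a. w (insert a J)) \<le> (\<Sum>J\<in>P a. l * m * w J + (if J \<in> N then l * w J else 0))"
  proof (rule sum_mono)
    fix J assume J: "J \<in> P a"
    then have "J \<subseteq> {..<a}" by (auto simp: P_def)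
    from run_weight_insert[OF this, of l m] w0[of J] assms J
    show "w (insert a J) \<le> l * m * w J + (if J \<in> N then l * w J else 0)"
      by (auto simp: N_def w_def)
  qed
  also have "\<dots> = l * m * A + l * sum w N"
  proof -
    have "(\<Sum>J\<in>P a. if J \<in> N then l * w J else 0) = (\<Sum>J\<in>N. l * w J)"
      using finP by (intro sum.mono_neutral_cong_right) (auto simp: N_def)
    then show ?thesis by (simp add: sum.distrib A_def sum_distrib_left)
  qed
  also have "\<dots> \<le> l * m * A + l * (3 * (2 * l * m * A))"
    using N assms by (intro add_left_mono mult_left_mono) auto
  \<comment> \<open>The factor 6 is 3 places for the largest element times the 2 of the induction
    hypothesis; \<open>6 * l \<le> 1\<close> absorbs it.\<close>
  also have "\<dots> = l * m * A + (6 * l) * (l * m * A)" by simp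
  also have "\<dots> \<le> l * m * A + 1 * (l * m * A)"
    using assms A0 by (intro add_left_mono mult_right_mono) auto
  finally show ?case by (simp add: w_def P_def A_def)
qed

text \<open>Admitting the elements of \<open>T\<close> in increasing order, each one multiplies the
  sum by at most \<open>1 + 2 * l * m\<close>. The gain over the trivial \<open>1 + l\<close> is the
  factor \<open>m\<close>: continuing runs cost only a constant factor overall.\<close>

lemma sum_run_weight_le:
  assumes "finite T" "0 \<le> l" "6 * l \<le> 1" "0 \<le> m"
  shows "(\<Sum>J\<in>Pow T. run_weight l m J) \<le> (1 + 2 * l * m) ^ card T"
proof -
  have *: "(\<Sum>J\<in>Pow (T \<inter> {..<N}). run_weight l m J) \<le> (1 + 2 * l * m) ^ card (T \<inter> {..<N})" for N
  proof (induction N)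
    case (Suc N)
    show ?case
    proof (cases "N \<in> T")
      case True
      then have eq: "T \<inter> {..<Suc N} = insert N (T \<inter> {..<N})" by auto
      have inj: "inj_on (insert N) (Pow (T \<inter> {..<N}))" by (auto simp: inj_on_def)
      have "(\<Sum>J\<in>Pow (T \<inter> {..<Suc N}). run_weight l m J) =
        (\<Sum>J\<in>Pow (T \<inter> {..<N}). run_weight l m J) +
        (\<Sum>J\<in>insert N ` Pow (T \<inter> {..<N}). run_weight l m J)"
        unfolding eq Pow_insert by (intro sum.union_disjoint) auto
      also have "\<dots> \<le> (1 + 2 * l * m) * (\<Sum>J\<in>Pow (T \<inter> {..<N}). run_weight l m J)"
        using sum_run_weight_insert_le[OF assms(2-4), where T = T and a = N]
        unfolding sum.reindex[OF inj] o_def by (simp only: distrib_right mult_1)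
      also have "\<dots> \<le> (1 + 2 * l * m) * (1 + 2 * l * m) ^ card (T \<inter> {..<N})"
        using Suc assms by (intro mult_left_mono) auto
      finally show ?thesis by (simp add: eq)
    next
      case False
      then have "T \<inter> {..<Suc N} = T \<inter> {..<N}" by (auto simp: less_Suc_eq)
      then show ?thesis using Suc by simp
    qed
  qed simp
  obtain N where "T \<subseteq> {..<N}" using assms(1) finite_nat_iff_bounded by blast
  then have "T \<inter> {..<N} = T" by auto
  then show ?thesis using *[of N] by simp
qed

lemma run_weight_scale: "c ^ card J * run_weight l m J = run_weight (c * l) m J"
  by (simp add: run_weight_def power_mult_distrib)

lemma run_weight_mono: "0 \<le> l \<Longrightarrow> l \<le> l' \<Longrightarrow> 0 \<le> m \<Longrightarrow> run_weight l m J \<le> run_weight l' m J"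
  unfolding run_weight_def by (intro mult_right_mono power_mono) auto

text \<open>Doubling \<open>l\<close> releases a factor \<open>(1 / 2) ^ card J\<close>, which is at
  most \<open>(1 / 2) ^ k\<close>. The condition \<open>12 * l \<le> 1\<close> is the earlier
  \<open>6 * l \<le> 1\<close> for the doubled value.\<close>

lemma sum_large_run_weight_le:
  assumes "finite T" "0 \<le> l" "12 * l \<le> 1" "0 \<le> m"
  shows "(\<Sum>J | J \<subseteq> T \<and> k \<le> card J. run_weight l m J) \<le> (1 / 2) ^ k * (1 + 4 * l * m) ^ card T"
proof -
  have "(\<Sum>J | J \<subseteq> T \<and> k \<le> card J. run_weight l m J) \<le>
      (\<Sum>J | J \<subseteq> T \<and> k \<le> card J. (1 / 2) ^ k * run_weight (2 * l) m J)"
  proof (rule sum_mono)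
    fix J assume J: "J \<in> {J. J \<subseteq> T \<and> k \<le> card J}"
    have "run_weight l m J = (1 / 2) ^ card J * run_weight (2 * l) m J"
      by (simp add: run_weight_scale)
    also have "\<dots> \<le> (1 / 2) ^ k * run_weight (2 * l) m J"
      using J assms by (intro mult_right_mono power_decreasing run_weight_nonneg) auto
    finally show "run_weight l m J \<le> (1 / 2) ^ k * run_weight (2 * l) m J" .
  qed
  also have "\<dots> \<le> (\<Sum>J\<in>Pow T. (1 / 2) ^ k * run_weight (2 * l) m J)"
    using assms by (intro sum_mono2 mult_nonneg_nonneg run_weight_nonneg) auto
  also have "\<dots> = (1 / 2) ^ k * (\<Sum>J\<in>Pow T. run_weight (2 * l) m J)"
    by (simp add: sum_distrib_left)
  also have "\<dots> \<le> (1 / 2) ^ k * (1 + 2 * (2 * l) * m) ^ card T"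
    using assms by (intro mult_left_mono sum_run_weight_le) auto
  finally show ?thesis by simp
qed

lemma power_one_plus_le_exp:
  assumes "0 \<le> x"
  shows "(1 + x) ^ n \<le> exp (real n * x)"
proof -
  have "(1 + x) ^ n \<le> exp x ^ n" using assms exp_ge_add_one_self[of x] by (intro power_mono) auto
  then show ?thesis by (simp add: exp_of_nat_mult)
qed

lemma power_half_le_exp: "(1 / 2) ^ k \<le> exp (- real k / 2)"
proof -
  have "exp (1 / 2 :: real) \<le> 1 + 2 * (1 / 2)" using exp_bound_lemma[of "1 / 2 :: real"] by simp
  then have "1 / 2 \<le> exp (- 1 / 2 :: real)" by (simp add: exp_minus field_simps)
  then have "(1 / 2) ^ k \<le> exp (- 1 / 2 :: real) ^ k" by (intro power_mono) auto
  also have "\<dots> = exp (- real k / 2)" by (simp flip: exp_of_nat_mult)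
  finally show ?thesis .
qed

section \<open>Permutations mapping a forest into a graph of bounded degree\<close>

definition touched :: "('a \<times> 'a) list \<Rightarrow> 'a set" where
  "touched ps = fst ` set ps \<union> snd ` set ps"

lemma touched_simps [simp]: "touched [] = {}" "touched ((x, y) # ps) = insert x (insert y (touched ps))"
  by (auto simp: touched_def)

lemma finite_touched [simp]: "finite (touched ps)"
  by (simp add: touched_def)

lemma card_touched_le: "card (touched ps) \<le> 2 * length ps"
proof -
  have "card (touched ps) \<le> card (fst ` set ps) + card (snd ` set ps)"
    unfolding touched_def by (rule card_Un_le)
  also have "card (fst ` set ps) \<le> length ps"
    by (metis card_length length_map set_map)
  also have "card (snd ` set ps) \<le> length ps"
    by (metis card_length length_map set_map)
  finally show ?thesis by simp
qed

text \<open>The pairs are listed in reverse order of construction: \<open>x\<close> is a new leaf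
  hung on \<open>y\<close>, which may be old or new. The counting strips one leaf at a time from the
  front.\<close>

fun forest :: "('a \<times> 'a) list \<Rightarrow> bool" where
  "forest [] = True"
| "forest ((x, y) # ps) = (forest ps \<and> x \<noteq> y \<and> x \<notin> touched ps)"

definition hom_perms :: "'a set \<Rightarrow> ('a \<Rightarrow> 'a \<Rightarrow> bool) \<Rightarrow> ('a \<times> 'a) list \<Rightarrow> ('a \<Rightarrow> 'a) set" where
  "hom_perms V E ps = {\<phi>. \<phi> permutes V \<and> (\<forall>(x, y)\<in>set ps. E (\<phi> x) (\<phi> y))}"

lemma finite_hom_perms: "finite V \<Longrightarrow> finite (hom_perms V E ps)"
  by (rule finite_subset[OF _ finite_permutations[of V]]) (auto simp: hom_perms_def)

text \<open>Switching: exchange the image of the new leaf \<open>x\<close> with that of any untouched vertex \<open>z\<close>.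
  The pair is recovered from the result and \<open>z\<close>, and \<open>z\<close> is mapped next to the image of \<open>y\<close>.\<close>

lemma card_hom_perms_Cons:
  assumes V: "finite V" and xy: "x \<in> V" "y \<in> V" "x \<noteq> y" and x: "x \<notin> touched ps"
    and ps: "touched ps \<subseteq> V" and deg: "\<And>u. u \<in> V \<Longrightarrow> card {v \<in> V. E v u} \<le> d"
  shows "card (V - insert y (touched ps)) * card (hom_perms V E ((x, y) # ps)) \<le>
    d * card (hom_perms V E ps)"
proof -
  define Q where "Q = V - insert y (touched ps)"
  define H where "H = hom_perms V E ps"
  define D where "D = (\<lambda>\<psi>. {z \<in> V. E (\<psi> z) (\<psi> y)})"
  define f where "f = (\<lambda>(\<phi>, z). (\<phi> \<circ> Transposition.transpose x z :: 'a \<Rightarrow> 'a, z))"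
  have finH: "finite H" using V by (simp add: H_def finite_hom_perms)
  have finD: "finite (D \<psi>)" for \<psi> using V by (simp add: D_def)
  have cardD: "card (D \<psi>) \<le> d" if "\<psi> \<in> H" for \<psi>
  proof -
    have p: "\<psi> permutes V" using that by (simp add: H_def hom_perms_def)
    have "card (D \<psi>) \<le> card {v \<in> V. E v (\<psi> y)}"
      using V permutes_inj_on[OF p] permutes_in_image[OF p]
      by (intro card_inj_on_le[of \<psi>]) (auto simp: D_def)
    also have "\<dots> \<le> d" using deg permutes_in_image[OF p] xy by blast
    finally show ?thesis .
  qed
  have "card Q * card (hom_perms V E ((x, y) # ps)) = card (hom_perms V E ((x, y) # ps) \<times> Q)"
    by (simp add: card_cartesian_product)
  also have "\<dots> \<le> card (Sigma H D)"
  proof (rule card_inj_on_le[of f])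
    show "inj_on f (hom_perms V E ((x, y) # ps) \<times> Q)"
    proof (rule inj_onI, clarsimp simp: f_def)
      fix \<phi> \<phi>' z assume "\<phi> \<circ> Transposition.transpose x z = \<phi>' \<circ> Transposition.transpose x z"
      then have "\<phi> \<circ> Transposition.transpose x z \<circ> Transposition.transpose x z =
          \<phi>' \<circ> Transposition.transpose x z \<circ> Transposition.transpose x z" by simp
      then show "\<phi> = \<phi>'" by (simp add: comp_assoc)
    qed
    show "f ` (hom_perms V E ((x, y) # ps) \<times> Q) \<subseteq> Sigma H D"
    proof (clarsimp simp: f_def)
      fix \<phi> z assume \<phi>: "\<phi> \<in> hom_perms V E ((x, y) # ps)" and z: "z \<in> Q"
      have p: "\<phi> permutes V" and e: "E (\<phi> x) (\<phi> y)"
        and es: "\<And>u v. (u, v) \<in> set ps \<Longrightarrow> E (\<phi> u) (\<phi> v)"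
        using \<phi> by (auto simp: hom_perms_def)
      have z': "z \<in> V" "z \<noteq> y" "z \<notin> touched ps" using z by (auto simp: Q_def)
      have same: "Transposition.transpose x z u = u" if "u \<in> touched ps" for u
        using that x z' by (intro transpose_apply_other) auto
      have "\<phi> \<circ> Transposition.transpose x z permutes V"
        using p xy z' by (intro permutes_compose permutes_swap_id) auto
      moreover have "E ((\<phi> \<circ> Transposition.transpose x z) u) ((\<phi> \<circ> Transposition.transpose x z) v)"
        if "(u, v) \<in> set ps" for u v
      proof -
        have "u \<in> touched ps" "v \<in> touched ps" using that by (force simp: touched_def)+
        then show ?thesis using es[OF that] by (simp add: same)
      qed
      ultimately have "\<phi> \<circ> Transposition.transpose x z \<in> H" by (auto simp: H_def hom_perms_def)
      moreover have "z \<in> D (\<phi> \<circ> Transposition.transpose x z)"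
        using e z' xy by (simp add: D_def transpose_apply_other)
      ultimately show "\<phi> \<circ> Transposition.transpose x z \<in> H \<and> z \<in> D (\<phi> \<circ> Transposition.transpose x z)"
        by blast
    qed
    show "finite (Sigma H D)" using finH finD by blast
  qed
  also have "\<dots> = (\<Sum>\<psi>\<in>H. card (D \<psi>))" using finH finD by (intro card_SigmaI) auto
  also have "\<dots> \<le> (\<Sum>\<psi>\<in>H. d)" by (intro sum_mono cardD)
  finally show ?thesis by (simp add: Q_def H_def mult.commute)
qed

text \<open>Iterated switching. \<open>R\<close> holds the leaves stripped so far, which no
  remaining pair touches. This yields \<open>card R + 1\<close> free vertices even when the forest
  spans almost all of \<open>V\<close>; for short lists the crude count
  \<open>card V - 2 * m\<close> is better.\<close>

lemma card_hom_perms_prod_le: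
  assumes V: "finite V" and deg: "\<And>u. u \<in> V \<Longrightarrow> card {v \<in> V. E v u} \<le> d"
    and "forest ps" "touched ps \<subseteq> V" "R \<subseteq> V" "R \<inter> touched ps = {}" "length ps + card R \<le> m"
  shows "card (hom_perms V E ps) * (\<Prod>i<length ps. max (card V - 2 * m) (card R + Suc i))
    \<le> d ^ length ps * fact (card V)"
  using assms(3-)
proof (induction ps arbitrary: R)
  case Nil
  have "hom_perms V E [] = {\<phi>. \<phi> permutes V}" by (auto simp: hom_perms_def)
  then show ?case using V by (simp add: card_permutations)
next
  case (Cons e ps)
  obtain x y where e: "e = (x, y)" by fastforce
  have xy: "x \<in> V" "y \<in> V" "x \<noteq> y" and x: "x \<notin> touched ps" and f: "forest ps"
    and tp: "touched ps \<subseteq> V" and R: "R \<subseteq> V" "x \<notin> R" "y \<notin> R" "R \<inter> touched ps = {}"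
    using Cons.prems by (auto simp: e)
  have finR: "finite R" using R(1) V finite_subset by blast
  have cR: "card (insert x R) = Suc (card R)" using finR R by simp
  have len: "Suc (length ps + card R) \<le> m" using Cons.prems by simp
  let ?C = "card (hom_perms V E (e # ps))"
  let ?M = "\<lambda>i. max (card V - 2 * m) (card R + Suc i)"
  let ?P = "\<Prod>i<length ps. max (card V - 2 * m) (card (insert x R) + Suc i)"
  have le: "?M 0 \<le> card (V - insert y (touched ps))"
  proof -
    have "card (insert x R) \<le> card (V - insert y (touched ps))"
      using V R xy x by (intro card_mono) auto
    moreover have "card (insert y (touched ps)) \<le> 2 * m"
      using card_insert_le_m1[of "Suc (2 * length ps)" "touched ps" y] card_touched_le[of ps] len by simp
    then have "card V - 2 * m \<le> card (V - insert y (touched ps))"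
      using diff_card_le_card_Diff[of "insert y (touched ps)" V] by simp
    ultimately show ?thesis using cR by simp
  qed
  have "(\<Prod>i<length (e # ps). ?M i) = ?M 0 * ?P"
    by (simp add: prod.lessThan_Suc_shift cR del: prod.lessThan_Suc)
  then have "?C * (\<Prod>i<length (e # ps). ?M i) = ?M 0 * ?C * ?P" by simp
  also have "\<dots> \<le> card (V - insert y (touched ps)) * ?C * ?P"
    using le by (intro mult_le_mono) auto
  also have "\<dots> \<le> d * card (hom_perms V E ps) * ?P"
    unfolding e using card_hom_perms_Cons[where E = E and d = d, OF V xy x tp deg] by (rule mult_le_mono1)
  also have "\<dots> = d * (card (hom_perms V E ps) * ?P)" by simp
  also have "\<dots> \<le> d * (d ^ length ps * fact (card V))"
    using f tp R xy x len cR by (intro mult_le_mono Cons.IH) auto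
  finally show ?case by simp
qed

lemma fact_ge_power_third: "(real m / 3) ^ m \<le> fact m"
proof (induction m)
  case (Suc m)
  show ?case
  proof (cases "m = 0")
    case False
    have "(1 + 1 / real m) ^ m \<le> exp 1"
      using exp_ge_one_plus_x_over_n_power_n[of m 1] False by simp
    also have "\<dots> \<le> 3" by (rule exp_le)
    finally have 3: "(1 + 1 / real m) ^ m \<le> 3" .
    have "real (Suc m) / 3 = (real m / 3) * (1 + 1 / real m)" using False by (simp add: field_simps)
    then have "(real (Suc m) / 3) ^ m = (real m / 3) ^ m * (1 + 1 / real m) ^ m"
      by (simp only: power_mult_distrib)
    also have "\<dots> \<le> fact m * 3" using Suc 3 by (intro mult_mono) auto
    finally have "real (Suc m) / 3 * (real (Suc m) / 3) ^ m \<le> real (Suc m) / 3 * (fact m * 3)"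
      by (intro mult_left_mono) auto
    then show ?thesis by simp
  qed simp
qed simp

lemma card_hom_perms_le:
  assumes V: "finite V" "V \<noteq> {}" and deg: "\<And>u. u \<in> V \<Longrightarrow> card {v \<in> V. E v u} \<le> d"
    and "forest ps" "touched ps \<subseteq> V"
  shows "real (card (hom_perms V E ps)) \<le> (12 * real d / real (card V)) ^ length ps * fact (card V)"
proof -
  define n where "n = card V"
  define m where "m = length ps"
  define P where "P = (\<Prod>i<m. max (n - 2 * m) (Suc i))"
  have n: "n > 0" using V by (simp add: n_def card_gt_0_iff)
  have "card (hom_perms V E ps) * P \<le> d ^ m * fact n"
    using card_hom_perms_prod_le[where E = E and d = d and R = "{}" and m = m, OF V(1) deg assms(4,5)] by (simp add: P_def n_def m_def)
  then have *: "real (card (hom_perms V E ps)) * real P \<le> real d ^ m * fact n"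
    by (metis of_nat_fact of_nat_le_iff of_nat_mult of_nat_power)
  \<comment> \<open>Origin of 12: if \<open>4 * m \<le> n\<close>, every factor is at least
    \<open>n / 2\<close>; otherwise the product is at least \<open>fact m\<close>, hence at least
    \<open>(m / 3) ^ m\<close>, where \<open>m > n / 4\<close>.\<close>
  have P: "(real n / 12) ^ m \<le> real P"
  proof (cases "4 * m \<le> n")
    case True
    have "(real n / 12) ^ m = (\<Prod>i<m. real n / 12)" by simp
    also have "\<dots> \<le> (\<Prod>i<m. real (max (n - 2 * m) (Suc i)))"
    proof (rule prod_mono)
      fix i
      have "n \<le> 2 * (n - 2 * m)" using True by simp
      also have "\<dots> \<le> 2 * max (n - 2 * m) (Suc i)" by simp
      finally have "real n \<le> 2 * real (max (n - 2 * m) (Suc i))" by linarith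
      then show "0 \<le> real n / 12 \<and> real n / 12 \<le> real (max (n - 2 * m) (Suc i))" by auto
    qed
    finally show ?thesis by (simp add: P_def)
  next
    case False
    have "(real n / 12) ^ m \<le> (real m / 3) ^ m" using False by (intro power_mono) auto
    also have "\<dots> \<le> fact m" by (rule fact_ge_power_third)
    also have "\<dots> = (\<Prod>i<m. real (Suc i))"
      by (simp add: fact_prod_Suc atLeast0LessThan)
    also have "\<dots> \<le> (\<Prod>i<m. real (max (n - 2 * m) (Suc i)))" by (intro prod_mono) auto
    finally show ?thesis by (simp add: P_def)
  qed
  have "real (card (hom_perms V E ps)) * (real n / 12) ^ m \<le> real (card (hom_perms V E ps)) * real P"
    using P by (intro mult_left_mono) auto
  also note *
  finally have "real (card (hom_perms V E ps)) * (real n / 12) ^ m \<le> real d ^ m * fact n" .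
  then show ?thesis
    using n by (simp add: n_def m_def power_divide power_mult_distrib field_simps)
qed

section \<open>Copies of the square of a Hamilton cycle\<close>

text \<open>The edges of the square of the cycle on \<open>{..<n}\<close> are numbered by \<open>a < 2 * n\<close>: the edges with numbers
  \<open>2 * j\<close> and \<open>2 * j + 1\<close> join \<open>j\<close> to \<open>j - 1\<close> and \<open>j - 2\<close> modulo \<open>n\<close>. Those that wrap around are
  0, 1 and 3.\<close>

definition sq_edge :: "nat \<Rightarrow> nat \<Rightarrow> nat set" where
  "sq_edge n a = {a div 2, (a div 2 + n - 1 - a mod 2) mod n}"

definition sq_edges :: "nat \<Rightarrow> nat set set" where
  "sq_edges n = sq_edge n ` {..<2 * n}"

text \<open>\<open>Suc\<close> moves from \<open>{..<n}\<close>, where arithmetic modulo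
  \<open>n\<close> is convenient, to the vertex set \<open>{1..n}\<close>.\<close>

definition relabel :: "(nat \<Rightarrow> nat) \<Rightarrow> nat set \<Rightarrow> nat set" where
  "relabel \<tau> e = (\<lambda>i. Suc (\<tau> i)) ` e"

text \<open>Permutations differing by a rotation of the cycle give the same copy, so copies come
  with multiplicity; proportions are taken among permutations.\<close>

definition sq_copy :: "nat \<Rightarrow> (nat \<Rightarrow> nat) \<Rightarrow> nat set set" where
  "sq_copy n \<tau> = relabel \<tau> ` sq_edges n"

lemma mod_less_double: "x < 2 * n \<Longrightarrow> x mod n = (if x < n then x else x - n)" for x n :: nat
  by (auto simp: le_mod_geq)

lemma sq_edges_Suc: "2 \<le> n \<Longrightarrow> i < n \<Longrightarrow> {i, Suc i mod n} \<in> sq_edges n"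
  unfolding sq_edges_def
  by (intro image_eqI[of _ _ "2 * (Suc i mod n)"])
    (auto simp: sq_edge_def mod_less_double)

lemma sq_edges_add2: "2 \<le> n \<Longrightarrow> i < n \<Longrightarrow> {i, (i + 2) mod n} \<in> sq_edges n"
  unfolding sq_edges_def
  by (intro image_eqI[of _ _ "2 * ((i + 2) mod n) + 1"])
    (auto simp: sq_edge_def mod_less_double)

lemma sq_edge_subset: "a < 2 * n \<Longrightarrow> sq_edge n a \<subseteq> {..<n}"
  by (auto simp: sq_edge_def)

lemma card_sq_edge:
  assumes "3 \<le> n" "a < 2 * n"
  shows "card (sq_edge n a) = 2"
proof -
  have "a mod 2 < 2" "a div 2 < n" using assms by auto
  then have "a div 2 \<noteq> (a div 2 + n - 1 - a mod 2) mod n"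
    using assms(1) by (auto simp: mod_less_double)
  then show ?thesis by (simp add: sq_edge_def)
qed

lemma sq_copy_subset:
  assumes "\<tau> permutes {..<n}" "3 \<le> n"
  shows "sq_copy n \<tau> \<subseteq> all_edges {1..n}"
proof
  fix e assume "e \<in> sq_copy n \<tau>"
  then obtain a where a: "a < 2 * n" "e = relabel \<tau> (sq_edge n a)"
    by (auto simp: sq_copy_def sq_edges_def)
  have "inj_on (\<lambda>i. Suc (\<tau> i)) (sq_edge n a)"
    using permutes_inj[OF assms(1)] by (auto simp: inj_on_def inj_def)
  then have "card e = 2" using a card_sq_edge[OF assms(2) a(1)] by (simp add: relabel_def card_image)
  moreover have "e \<subseteq> {1..n}"
  proof
    fix v assume "v \<in> e"
    then obtain i where i: "i \<in> sq_edge n a" "v = Suc (\<tau> i)" by (auto simp: a(2) relabel_def)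
    then have "\<tau> i < n" using sq_edge_subset[OF a(1)] permutes_in_image[OF assms(1), of i] by auto
    then show "v \<in> {1..n}" using i(2) by simp
  qed
  ultimately show "e \<in> all_edges {1..n}" by (simp add: all_edges_def)
qed

lemma contains_ham_cycle_square_if_sq_copy:
  assumes \<tau>: "\<tau> permutes {..<n}" and n: "3 \<le> n" and W: "sq_copy n \<tau> \<subseteq> W"
  shows "contains_ham_cycle_square (Graph {1..n} W)"
proof -
  define c where "c = (\<lambda>i. Suc (\<tau> i))"
  define C where "C = Graph {1..n} {{c i, c (Suc i mod n)} | i. i < n}"
  have "bij_betw \<tau> {..<n} {..<n}" using \<tau> by (rule permutes_imp_bij)
  moreover have "bij_betw Suc {..<n} {1..n}"
    by (rule bij_betwI[of _ _ _ "\<lambda>i. i - 1"]) auto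
  ultimately have bij: "bij_betw c {..<n} {1..n}"
    using bij_betw_trans[of \<tau> "{..<n}" "{..<n}" Suc "{1..n}"] by (simp add: c_def o_def)
  have cyc: "is_cycle C" unfolding is_cycle_def using n bij by (auto simp: C_def)
  have inj: "c i = c j \<longleftrightarrow> i = j" for i j
    using permutes_inj[OF \<tau>] by (auto simp: c_def inj_def)
  have copy: "{c i, c j} \<in> W" if "{i, j} \<in> sq_edges n" for i j
    using W that by (auto simp: sq_copy_def relabel_def c_def)
  have step: "(\<exists>i<n. u = c i \<and> v = c (Suc i mod n)) \<or> (\<exists>i<n. v = c i \<and> u = c (Suc i mod n))"
    if "{u, v} \<in> edges C" for u v
    using that by (auto simp: C_def doubleton_eq_iff)
  have "{u, v} \<in> W" if uv: "u \<noteq> v" "graph_dist C u v \<le> 2" for u v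
  proof -
    \<comment> \<open>The infimum in \<open>enat\<close> is handled by contradiction: were all walks
      longer, 3 would be a lower bound for their lengths.\<close>
    have "\<exists>xs. is_walk C xs \<and> hd xs = u \<and> last xs = v \<and> length xs \<le> 3"
    proof (rule ccontr)
      assume no: "\<not> ?thesis"
      have "3 \<le> graph_dist C u v"
        unfolding graph_dist_def
      proof (rule Inf_greatest, clarify)
        fix xs assume "is_walk C xs" "u = hd xs" "v = last xs"
        then have "3 \<le> length xs - 1" using no by force
        then show "3 \<le> enat (length xs - 1)" by (simp add: numeral_eq_enat)
      qed
      then have "(3 :: enat) \<le> 2" using uv(2) by (rule order_trans)
      then show False by simp
    qed
    then obtain xs where xs: "is_walk C xs" "hd xs = u" "last xs = v" "length xs \<le> 3" by blast
    from xs(1) have "xs \<noteq> []" by (simp add: is_walk_def)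
    then consider "length xs = 1" | "length xs = 2" | "length xs = 3"
      using xs(4) length_0_conv[of xs] by linarith
    then show ?thesis
    proof cases
      case 1
      then show ?thesis using xs uv by (auto simp: length_Suc_conv)
    next
      case 2
      then have "xs = [u, v]" using xs by (auto simp: length_Suc_conv numeral_2_eq_2)
      then have "{u, v} \<in> edges C" using xs(1) by (auto simp: is_walk_def)
      from step[OF this] show ?thesis
        using copy sq_edges_Suc n by (auto simp: insert_commute)
    next
      case 3
      then obtain w where "xs = [u, w, v]" using xs by (auto simp: length_Suc_conv numeral_3_eq_3)
      then have "{u, w} \<in> edges C" "{w, v} \<in> edges C"
        using xs(1) by (fastforce simp: is_walk_def nth_Cons split: nat.splits)+
      note st = step[OF this(1)] step[OF this(2)]
      have two: "{c i, c (Suc (Suc i mod n) mod n)} \<in> W" if "i < n" for i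
        using copy[OF sq_edges_add2[OF _ that]] n by (simp add: mod_Suc_eq)
      have pred: "i = j" if "i < n" "j < n" "Suc i mod n = Suc j mod n" for i j
        using that n by (auto simp: mod_less_double split: if_splits)
      \<comment> \<open>Two steps in the same direction join vertices two apart on the cycle; steps
        in opposite directions return to the start, against \<open>u \<noteq> v\<close>.\<close>
      from st(1) show ?thesis
      proof (elim disjE exE conjE)
        fix i assume i: "i < n" "u = c i" "w = c (Suc i mod n)"
        from st(2) show ?thesis
        proof (elim disjE exE conjE)
          fix k assume "w = c k" "v = c (Suc k mod n)"
          then show ?thesis using i two[OF i(1)] by (simp add: inj)
        next
          fix k assume "k < n" "v = c k" "w = c (Suc k mod n)"
          then show ?thesis using i uv(1) pred[of i k] by (simp add: inj)
        qed
      next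
        fix i assume i: "i < n" "w = c i" "u = c (Suc i mod n)"
        from st(2) show ?thesis
        proof (elim disjE exE conjE)
          fix k assume "w = c k" "v = c (Suc k mod n)"
          then show ?thesis using i uv(1) by (simp add: inj)
        next
          fix k assume "k < n" "v = c k" "w = c (Suc k mod n)"
          then show ?thesis using i two[of k] by (simp add: inj insert_commute)
        qed
      qed
    qed
  qed
  then have "edges (graph_square C) \<subseteq> W" by (auto simp: graph_square_def)
  then show ?thesis unfolding contains_ham_cycle_square_def subgraph_def
    using cyc by (intro exI[of _ C]) (auto simp: C_def graph_square_def)
qed

section \<open>Degrees and forests in the squared cycle\<close>

lemma sq_edges_degree:
  assumes "3 \<le> n" "u < n"
  shows "card {v \<in> {..<n}. {v, u} \<in> sq_edges n} \<le> 4"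
proof -
  let ?N = "{(u + 1) mod n, (u + 2) mod n, (u + n - 1) mod n, (u + n - 2) mod n}"
  have "{v \<in> {..<n}. {v, u} \<in> sq_edges n} \<subseteq> ?N"
  proof
    fix v assume "v \<in> {v \<in> {..<n}. {v, u} \<in> sq_edges n}"
    then obtain a where v: "v < n" and a: "a < 2 * n" "{v, u} = sq_edge n a"
      by (auto simp: sq_edges_def)
    define j r where "j = a div 2" and "r = a mod 2"
    have r: "r = 0 \<or> r = 1" and j: "j < n" using a(1) by (auto simp: j_def r_def)
    have "{v, u} = {j, (j + n - 1 - r) mod n}" using a(2) by (simp add: sq_edge_def j_def r_def)
    then consider "u = j" "v = (j + n - 1 - r) mod n" | "v = j" "u = (j + n - 1 - r) mod n"
      by (auto simp: doubleton_eq_iff)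
    then show "v \<in> ?N"
    proof cases
      case 1
      then show ?thesis using r by (auto simp: numeral_2_eq_2)
    next
      case 2
      have "(u + (1 + r)) mod n = (j + n - 1 - r + (1 + r)) mod n"
        unfolding 2 by (rule mod_add_left_eq)
      also have "j + n - 1 - r + (1 + r) = j + n" using r assms(1) by auto
      finally have "(u + (1 + r)) mod n = v" using j 2 by simp
      then show ?thesis using r by auto
    qed
  qed
  then have "card {v \<in> {..<n}. {v, u} \<in> sq_edges n} \<le> card ?N" by (intro card_mono) auto
  also have "\<dots> \<le> 4" using card_length[of "[(u + 1) mod n, (u + 2) mod n, (u + n - 1) mod n, (u + n - 2) mod n]"]
    by simp
  finally show ?thesis .
qed

lemma card_Int_lessThan_Suc_double:
  "card (X \<inter> {..<2 * Suc j}) =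
    card (X \<inter> {..<2 * j}) + of_bool (2 * j \<in> X) + of_bool (2 * j + 1 \<in> X)" for X :: "nat set"
proof -
  have *: "card (X \<inter> {..<Suc m}) = card (X \<inter> {..<m}) + of_bool (m \<in> X)" for m
  proof (cases "m \<in> X")
    case True
    then have "X \<inter> {..<Suc m} = insert m (X \<inter> {..<m})" by auto
    then show ?thesis using True by simp
  next
    case False
    then have "X \<inter> {..<Suc m} = X \<inter> {..<m}" by (auto simp: less_Suc_eq)
    then show ?thesis using False by simp
  qed
  show ?thesis using *[of "2 * j"] *[of "2 * j + 1"] by simp
qed

text \<open>Scan the vertices from left to right and join each one that has an edge backwards to one of
  its two predecessors. This yields at least half as many tree edges as edges. There is a surplus
  at the first such vertex \<open>j\<close> of a run: either it has a single backward edge, or both its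
  backward edges can be kept since \<open>j - 1\<close> is still isolated.\<close>

lemma forest_in_sq_edges:
  assumes wrap: "0 \<notin> J" "1 \<notin> J" "3 \<notin> J" and "j \<le> n"
  shows "\<exists>ps. forest ps \<and> touched ps \<subseteq> {..<j} \<and> (\<forall>(x, y)\<in>set ps. {x, y} \<in> sq_edge n ` J) \<and>
    card (J \<inter> {..<2 * j}) + card (run_starts J \<inter> {..<2 * j}) \<le> 2 * length ps \<and>
    (1 \<le> j \<longrightarrow> 2 * (j - 1) \<notin> J \<longrightarrow> 2 * (j - 1) + 1 \<notin> J \<longrightarrow> j - 1 \<notin> touched ps)"
  using \<open>j \<le> n\<close>
proof (induction j)
  case 0
  then show ?case by (intro exI[of _ "[]"]) auto
next
  case (Suc j)
  then obtain ps where ps: "forest ps" "touched ps \<subseteq> {..<j}"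
    "\<And>x y. (x, y) \<in> set ps \<Longrightarrow> {x, y} \<in> sq_edge n ` J"
    "card (J \<inter> {..<2 * j}) + card (run_starts J \<inter> {..<2 * j}) \<le> 2 * length ps"
    "1 \<le> j \<Longrightarrow> 2 * (j - 1) \<notin> J \<Longrightarrow> 2 * (j - 1) + 1 \<notin> J \<Longrightarrow> j - 1 \<notin> touched ps"
    by fastforce
  have jn: "j < n" using Suc.prems by simp
  note cJ = card_Int_lessThan_Suc_double[of J j]
  note cS = card_Int_lessThan_Suc_double[of "run_starts J" j]
  have st: "a \<in> run_starts J \<Longrightarrow> a \<in> J" for a by (auto simp: run_starts_def)
  have st': "2 * j \<in> J \<Longrightarrow> 2 * j + 1 \<notin> run_starts J" by (auto simp: run_starts_def)
  have jt: "j \<notin> touched ps" using ps(2) by auto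
  have e1: "sq_edge n (2 * j) = {j, j - 1}" "1 \<le> j" if "2 * j \<in> J"
  proof -
    show "1 \<le> j" using that wrap(1) by (cases j) auto
    then show "sq_edge n (2 * j) = {j, j - 1}" using jn by (simp add: sq_edge_def mod_less_double)
  qed
  have e2: "sq_edge n (2 * j + 1) = {j, j - 2}" "2 \<le> j" if "2 * j + 1 \<in> J"
  proof -
    have "j \<noteq> 0" using that wrap(2) by (cases j) auto
    moreover have "j \<noteq> 1" using that wrap(3) by auto
    ultimately show "2 \<le> j" by simp
    then show "sq_edge n (2 * j + 1) = {j, j - 2}" using jn by (simp add: sq_edge_def mod_less_double)
  qed
  consider (none) "2 * j \<notin> J" "2 * j + 1 \<notin> J"
    | (both) "2 * j \<in> J" "2 * j + 1 \<in> J" "2 * (j - 1) \<notin> J" "2 * (j - 1) + 1 \<notin> J"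
    | (one) "2 * j \<in> J \<or> 2 * j + 1 \<in> J"
      "\<not> (2 * j \<in> J \<and> 2 * j + 1 \<in> J \<and> 2 * (j - 1) \<notin> J \<and> 2 * (j - 1) + 1 \<notin> J)"
    by blast
  then show ?case
  proof cases
    case none
    then have "2 * j \<notin> run_starts J" "2 * j + 1 \<notin> run_starts J" using st by auto
    then show ?thesis using none ps jt cJ cS by (intro exI[of _ ps]) auto
  next
    case both
    have 2: "2 \<le> j" using e2 both by blast
    then have "j - 1 \<notin> touched ps" using ps(5) both by simp
    moreover have "j - 1 \<noteq> j" "j - 1 \<noteq> j - 2" "j \<noteq> j - 2" using 2 by auto
    \<comment> \<open>The vertex \<open>j\<close> is hung on \<open>j - 2\<close> as a leaf, and
      then the isolated \<open>j - 1\<close> is hung on \<open>j\<close>. Two tree edges pay for two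
      edges and the possible new start \<open>2 * j\<close>.\<close>
    ultimately have "forest ((j - 1, j) # (j, j - 2) # ps)" using ps(1) jt by auto
    moreover have "touched ((j - 1, j) # (j, j - 2) # ps) \<subseteq> {..<Suc j}" using ps(2) by auto
    moreover have "\<forall>(x, y)\<in>set ((j - 1, j) # (j, j - 2) # ps). {x, y} \<in> sq_edge n ` J"
      using ps(3) e1(1) e2(1) both by (auto simp: insert_commute intro: rev_image_eqI)
    moreover have "2 * j + 1 \<notin> run_starts J" using st' both by blast
    then have "card (J \<inter> {..<2 * Suc j}) + card (run_starts J \<inter> {..<2 * Suc j})
        \<le> 2 * length ((j - 1, j) # (j, j - 2) # ps)"
      using ps(4) unfolding cJ cS by simp
    ultimately show ?thesis using both by (intro exI[of _ "(j - 1, j) # (j, j - 2) # ps"]) auto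
  next
    case one
    define k where "k = (if 2 * j \<in> J then j - 1 else j - 2)"
    have k: "k < j" "{j, k} \<in> sq_edge n ` J"
      using one(1) e1 e2 by (auto simp: k_def intro: rev_image_eqI)
    have "card (J \<inter> {..<2 * Suc j}) + card (run_starts J \<inter> {..<2 * Suc j}) \<le> 2 * length ((j, k) # ps)"
    proof (cases "2 * j \<in> J \<and> 2 * j + 1 \<in> J")
      case True
      \<comment> \<open>The predecessor has an edge numbered at least \<open>2 * j - 2\<close>,
        within distance 3 of \<open>2 * j\<close>, so no run starts here and one tree edge pays for
        both edges.\<close>
      then have "2 * (j - 1) \<in> J \<or> 2 * (j - 1) + 1 \<in> J" "1 \<le> j" using one e1 by auto
      then have "2 * j \<notin> run_starts J" by (force simp: run_starts_def)
      then show ?thesis using ps(4) st' True unfolding cJ cS by simp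
    next
      case False
      then have "2 * j \<notin> run_starts J \<or> 2 * j + 1 \<notin> run_starts J" using st by blast
      then show ?thesis using ps(4) False unfolding cJ cS by auto
    qed
    then show ?thesis using ps k jt one(1) by (intro exI[of _ "(j, k) # ps"]) auto
  qed
qed

text \<open>Each forest edge is worth \<open>x\<^sup>2\<close> with
  \<open>x = sqrt (48 / n) \<le> 1\<close>, so \<open>2 * m\<close> may be lowered to the number of
  edges plus runs. As there are at most as many runs as edges, the constants collect into
  \<open>48 ^ card J\<close>.\<close>

lemma power_half_run_weight:
  assumes "48 \<le> n" "finite J" "card J + card (run_starts J) \<le> 2 * m"
  shows "(48 / real n) ^ m \<le> run_weight (48 / sqrt n) (1 / sqrt n) J"
proof -
  define x where "x = sqrt 48 / sqrt n"
  define s where "s = card (run_starts J)"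
  have s: "s \<le> card J" unfolding s_def using assms(2) run_starts_subset by (rule card_mono)
  have n: "0 < real n" "48 \<le> real n" using assms(1) by auto
  have x: "0 \<le> x" "x \<le> 1" using n by (auto simp: x_def)
  have x2: "48 / real n = x\<^sup>2" using n by (simp add: x_def power_divide)
  have "(48 / real n) ^ m = x ^ (2 * m)" by (simp add: x2 power_mult)
  also have "\<dots> \<le> x ^ (card J + s)" using x assms(3) by (intro power_decreasing) (auto simp: s_def)
  also have "\<dots> = sqrt 48 ^ (card J + s) * (1 / sqrt n) ^ (card J + s)"
    by (simp add: x_def power_divide)
  also have "\<dots> \<le> sqrt 48 ^ (2 * card J) * (1 / sqrt n) ^ (card J + s)"
    using s by (intro mult_right_mono power_increasing) auto
  also have "sqrt 48 ^ (2 * card J) = (48 :: real) ^ card J" by (simp add: power_mult)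
  finally show ?thesis
    by (simp add: run_weight_def s_def power_add power_divide)
qed

text \<open>Passing to \<open>inv \<tau> \<circ> \<rho>\<close> turns a fixed edge set inside a
  varying copy into a fixed forest mapped by a varying permutation into the fixed squared cycle. The
  constant is \<open>48 = 12 * 4\<close>, with 4 the degree bound.\<close>

lemma card_sq_copy_containing_le:
  assumes \<rho>: "\<rho> permutes {..<n}" and n: "48 \<le> n" and J: "J \<subseteq> {..<2 * n} - {0, 1, 3}"
  shows "real (card {\<tau>. \<tau> permutes {..<n} \<and> relabel \<rho> ` sq_edge n ` J \<subseteq> sq_copy n \<tau>})
    \<le> fact n * run_weight (48 / sqrt n) (1 / sqrt n) J"
proof -
  let ?E = "\<lambda>u v. {u, v} \<in> sq_edges n"
  let ?A = "{\<tau>. \<tau> permutes {..<n} \<and> relabel \<rho> ` sq_edge n ` J \<subseteq> sq_copy n \<tau>}"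
  have "J \<inter> {..<2 * n} = J" "run_starts J \<inter> {..<2 * n} = run_starts J"
    using J run_starts_subset[of J] by auto
  with forest_in_sq_edges[of J n n] J obtain ps where ps: "forest ps" "touched ps \<subseteq> {..<n}"
    "\<And>x y. (x, y) \<in> set ps \<Longrightarrow> {x, y} \<in> sq_edge n ` J"
    "card J + card (run_starts J) \<le> 2 * length ps"
    by fastforce
  have finJ: "finite J" using J finite_subset by blast
  have "card ?A \<le> card (hom_perms {..<n} ?E ps)"
  proof (rule card_inj_on_le[of "\<lambda>\<tau>. inv \<tau> \<circ> \<rho>"])
    show "inj_on (\<lambda>\<tau>. inv \<tau> \<circ> \<rho>) ?A"
    proof (rule inj_onI)
      fix \<tau> \<tau>' assume t: "\<tau> \<in> ?A" "\<tau>' \<in> ?A" and eq: "inv \<tau> \<circ> \<rho> = inv \<tau>' \<circ> \<rho>"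
      have "inv \<tau> \<circ> (\<rho> \<circ> inv \<rho>) = inv \<tau>' \<circ> (\<rho> \<circ> inv \<rho>)" using eq by (simp add: o_assoc)
      then have "inv \<tau> = inv \<tau>'" using permutes_inv_o(1)[OF \<rho>] by simp
      then have "inv (inv \<tau>) = inv (inv \<tau>')" by (rule arg_cong)
      moreover have "inv (inv \<tau>) = \<tau>" "inv (inv \<tau>') = \<tau>'"
        using t permutes_inv_inv by auto
      ultimately show "\<tau> = \<tau>'" by (simp only:)
    qed
    show "(\<lambda>\<tau>. inv \<tau> \<circ> \<rho>) ` ?A \<subseteq> hom_perms {..<n} ?E ps"
    proof (rule image_subsetI)
      fix \<tau> assume "\<tau> \<in> ?A"
      then have \<tau>: "\<tau> permutes {..<n}" and sub: "relabel \<rho> ` sq_edge n ` J \<subseteq> sq_copy n \<tau>" by auto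
      have "?E ((inv \<tau> \<circ> \<rho>) x) ((inv \<tau> \<circ> \<rho>) y)" if "(x, y) \<in> set ps" for x y
      proof -
        have "relabel \<rho> {x, y} \<in> sq_copy n \<tau>" using ps(3)[OF that] sub by blast
        then obtain e where e: "e \<in> sq_edges n" "relabel \<rho> {x, y} = relabel \<tau> e"
          by (auto simp: sq_copy_def)
        have "Suc ` {\<rho> x, \<rho> y} = Suc ` (\<tau> ` e)" using e(2) by (simp add: relabel_def image_image)
        then have "{\<rho> x, \<rho> y} = \<tau> ` e" using inj_image_eq_iff[OF inj_Suc] by blast
        then have "inv \<tau> ` {\<rho> x, \<rho> y} = inv \<tau> ` \<tau> ` e" by simp
        then have "{inv \<tau> (\<rho> x), inv \<tau> (\<rho> y)} = e"
          using image_inv_f_f[OF permutes_inj[OF \<tau>]] by simp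
        then show ?thesis using e(1) by simp
      qed
      then show "inv \<tau> \<circ> \<rho> \<in> hom_perms {..<n} ?E ps"
        using permutes_compose[OF \<rho> permutes_inv[OF \<tau>]] by (auto simp: hom_perms_def)
    qed
    show "finite (hom_perms {..<n} ?E ps)" by (simp add: finite_hom_perms)
  qed
  then have "real (card ?A) \<le> real (card (hom_perms {..<n} ?E ps))" by simp
  also have "\<dots> \<le> (12 * real 4 / real (card {..<n})) ^ length ps * fact (card {..<n})"
  proof (rule card_hom_perms_le)
    show "{..<n} \<noteq> {}" using n by (simp add: lessThan_empty_iff)
    show "card {v \<in> {..<n}. ?E v u} \<le> 4" if "u \<in> {..<n}" for u
      using sq_edges_degree[of n u] n that by simp
  qed (use ps in auto)
  also have "\<dots> = fact n * (48 / real n) ^ length ps" by simp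
  also have "\<dots> \<le> fact n * run_weight (48 / sqrt n) (1 / sqrt n) J"
    using power_half_run_weight[OF n finJ ps(4)] by (intro mult_left_mono) auto
  finally show ?thesis .
qed

text \<open>Deleting the three edges through the cut costs a factor of at most \<open>n\<^sup>3\<close>.\<close>

lemma card_sq_copy_containing_le':
  assumes \<rho>: "\<rho> permutes {..<n}" and n: "48 \<le> n" and J: "J \<subseteq> {..<2 * n}"
  shows "real (card {\<tau>. \<tau> permutes {..<n} \<and> relabel \<rho> ` sq_edge n ` J \<subseteq> sq_copy n \<tau>})
    \<le> fact n * real n ^ 3 * run_weight (48 / sqrt n) (1 / sqrt n) J"
proof -
  define J' where "J' = J - {0, 1, 3}"
  define m where "m = 1 / sqrt (real n)"
  have sn: "1 \<le> sqrt (real n)" using n by simp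
  have m: "0 < m" "m \<le> 1" using sn by (auto simp: m_def)
  have finJ: "finite J" using J finite_subset by blast
  have c3: "card {0, 1, 3 :: nat} = 3" by simp
  have cJ: "card J \<le> card J' + 3" "card J' \<le> card J"
    using diff_card_le_card_Diff[of "{0, 1, 3}" J] finJ c3 by (auto simp: J'_def intro!: card_mono)
  \<comment> \<open>Deleting elements may create starts but destroys only those deleted.\<close>
  have "run_starts J - {0, 1, 3} \<subseteq> run_starts J'" by (auto simp: run_starts_def J'_def)
  then have "card (run_starts J - {0, 1, 3}) \<le> card (run_starts J')"
    using finJ run_starts_subset[of J'] by (intro card_mono) (auto simp: J'_def intro: finite_subset)
  then have cS: "card (run_starts J) \<le> card (run_starts J') + 3"
    using diff_card_le_card_Diff[of "{0, 1, 3}" "run_starts J"] c3 by simp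
  have "real (card {\<tau>. \<tau> permutes {..<n} \<and> relabel \<rho> ` sq_edge n ` J \<subseteq> sq_copy n \<tau>}) \<le>
      real (card {\<tau>. \<tau> permutes {..<n} \<and> relabel \<rho> ` sq_edge n ` J' \<subseteq> sq_copy n \<tau>})"
    by (intro of_nat_mono card_mono finite_subset[OF _ finite_permutations[of "{..<n}"]])
      (auto simp: J'_def)
  also have "\<dots> \<le> fact n * run_weight (48 / sqrt n) (1 / sqrt n) J'"
    using J by (intro card_sq_copy_containing_le assms) (auto simp: J'_def)
  also have "run_weight (48 / sqrt n) (1 / sqrt n) J' =
      48 ^ card J' * (m ^ card J' * m ^ card (run_starts J'))"
    by (simp add: run_weight_def m_def power_divide)
  \<comment> \<open>Edges and runs drop by at most 3 each. The six missing factors \<open>m\<close>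
    are supplied by \<open>n\<^sup>3 * m ^ 6 = 1\<close>.\<close>
  also have "\<dots> \<le> 48 ^ card J * ((real n ^ 3 * m ^ 6) * (m ^ card J' * m ^ card (run_starts J')))"
  proof -
    have "m\<^sup>2 = 1 / real n" by (simp add: m_def power_divide)
    then have "real n ^ 3 * (m\<^sup>2) ^ 3 = 1" using n by (simp add: power_divide)
    then have "real n ^ 3 * m ^ 6 = 1" by (simp flip: power_mult)
    moreover have "(48 :: real) ^ card J' \<le> 48 ^ card J" using cJ by (intro power_increasing) auto
    ultimately show ?thesis using m by (simp only: mult_1) (intro mult_right_mono, auto)
  qed
  also have "\<dots> = 48 ^ card J * (real n ^ 3 * (m ^ (card J' + 3) * m ^ (card (run_starts J') + 3)))"
    by (simp add: power_add eval_nat_numeral mult_ac)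
  also have "\<dots> \<le> 48 ^ card J * (real n ^ 3 * (m ^ card J * m ^ card (run_starts J)))"
    using m cJ cS by (intro mult_left_mono mult_mono power_decreasing) auto
  also have "\<dots> = real n ^ 3 * run_weight (48 / sqrt n) (1 / sqrt n) J"
    by (simp add: run_weight_def m_def power_divide)
  finally show ?thesis by (simp add: mult_left_mono mult.assoc)
qed

section \<open>Cutting the cycle open\<close>

lemma permutes_rotation:
  fixes s n :: nat
  assumes "s < n"
  shows "(\<lambda>i. if i < n then (i + s) mod n else i) permutes {..<n}"
proof (rule bij_imp_permutes)
  show "bij_betw (\<lambda>i. if i < n then (i + s) mod n else i) {..<n} {..<n}"
    using assms
    by (intro bij_betwI[of _ _ _ "\<lambda>i. (i + n - s) mod n"]) (auto simp: mod_less_double)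
qed auto

text \<open>Each edge crossing the cut between \<open>s - 1\<close> and \<open>s\<close> contains
  one of these two vertices. After rotating \<open>s\<close> to 0, the crossing edges are those
  numbered 0, 1 and 3.\<close>

lemma sq_edge_rotation:
  assumes "3 \<le> n" "s < n" "a < 2 * n" "s \<notin> sq_edge n a" "(s + n - 1) mod n \<notin> sq_edge n a"
  shows "\<exists>b\<in>{..<2 * n} - {0, 1, 3}.
    sq_edge n a = (\<lambda>i. if i < n then (i + s) mod n else i) ` sq_edge n b"
proof -
  define j r where "j = a div 2" and "r = a mod 2"
  have r: "r = 0 \<or> r = 1" and j: "j < n" using assms(3) by (auto simp: j_def r_def)
  define i where "i = (j + n - s) mod n"
  have i: "i < n" using assms by (simp add: i_def)
  have ij: "(i + s) mod n = j"
    using assms(2) j by (auto simp: i_def mod_less_double)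
  have b: "(2 * i + r) div 2 = i" "r mod 2 = r" using r by auto
  have js: "j \<noteq> s" "(j + n - 1 - r) mod n \<noteq> (s + n - 1) mod n"
    using assms(4,5) by (auto simp: sq_edge_def j_def r_def)
  have i0: "i \<noteq> 0"
  proof
    assume "i = 0"
    then show False using ij js(1) assms(2) by simp
  qed
  have i1: "\<not> (i = 1 \<and> r = 1)"
    using js(2) j assms(1,2) ij by (auto simp: mod_less_double split: if_splits)
  have "((i + n - 1 - r) mod n + s) mod n = (j + n - 1 - r) mod n"
    unfolding ij[symmetric] using assms(1,2) i r by (auto simp: mod_less_double split: if_splits)
  then have "sq_edge n a = (\<lambda>i. if i < n then (i + s) mod n else i) ` sq_edge n (2 * i + r)"
    using i ij by (simp add: sq_edge_def b flip: j_def r_def)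
  moreover have "2 * i + r \<in> {..<2 * n} - {0, 1, 3}" using i i0 i1 r by (auto, presburger)
  ultimately show ?thesis by blast
qed

text \<open>A small set of edges misses some cut of the cycle, so a rotated labelling represents it
  without wrapping around.\<close>

lemma sq_copy_unwrap:
  assumes \<rho>: "\<rho> permutes {..<n}" and n: "3 \<le> n"
    and T: "T \<subseteq> sq_copy n \<rho>" "4 * card T < n"
  shows "\<exists>\<rho>'. \<rho>' permutes {..<n} \<and> T \<subseteq> relabel \<rho>' ` sq_edge n ` ({..<2 * n} - {0, 1, 3})"
proof -
  have finT: "finite T" using T(1) by (rule finite_subset) (simp add: sq_copy_def sq_edges_def)
  have c2: "card e = 2" if "e \<in> T" for e
    using that T(1) sq_copy_subset[OF \<rho> n] by (auto simp: all_edges_def)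
  have "card (\<Union> T) \<le> sum card T" using finT c2 by (intro card_Union_le_sum_card)
  also have "\<dots> = 2 * card T" using c2 by simp
  finally have cU: "card (\<Union> T) \<le> 2 * card T" .
  have finU: "finite (\<Union> T)" using finT c2 by (intro finite_Union) (auto intro: card_ge_0_finite)
  \<comment> \<open>The cuts spoiled by \<open>T\<close>. It covers at most
    \<open>2 * card T\<close> vertices, each spoiling at most one \<open>s\<close> in either set, so
    fewer than \<open>n\<close> cuts are lost.\<close>
  define B1 B2 where "B1 = {s. s < n \<and> Suc (\<rho> s) \<in> \<Union> T}"
    and "B2 = {s. s < n \<and> Suc (\<rho> ((s + n - 1) mod n)) \<in> \<Union> T}"
  have inj: "\<rho> x = \<rho> y \<longleftrightarrow> x = y" for x y using permutes_inj[OF \<rho>] by (auto simp: inj_def)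
  have "card B1 \<le> card (\<Union> T)"
    using finU by (intro card_inj_on_le[of "\<lambda>s. Suc (\<rho> s)"]) (auto simp: B1_def inj_on_def inj)
  moreover have "card B2 \<le> card (\<Union> T)"
    using finU n by (intro card_inj_on_le[of "\<lambda>s. Suc (\<rho> ((s + n - 1) mod n))"])
      (auto simp: B2_def inj_on_def inj mod_less_double split: if_splits)
  moreover have "card (B1 \<union> B2) \<le> card B1 + card B2" by (rule card_Un_le)
  ultimately have "card (B1 \<union> B2) < card {..<n}" using cU T(2) by simp
  moreover have "finite (B1 \<union> B2)" by (simp add: B1_def B2_def)
  ultimately obtain s where "s < n" "s \<notin> B1 \<union> B2"
    by (metis card_mono leD lessThan_iff subsetI)
  then have s: "s < n" "Suc (\<rho> s) \<notin> \<Union> T" "Suc (\<rho> ((s + n - 1) mod n)) \<notin> \<Union> T"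
    by (auto simp: B1_def B2_def)
  define rot where "rot = (\<lambda>i. if i < n then (i + s) mod n else i)"
  have "\<rho> \<circ> rot permutes {..<n}"
    using permutes_compose[OF permutes_rotation[OF s(1)] \<rho>] by (simp add: rot_def)
  moreover have "T \<subseteq> relabel (\<rho> \<circ> rot) ` sq_edge n ` ({..<2 * n} - {0, 1, 3})"
  proof
    fix e assume e: "e \<in> T"
    then obtain a where a: "a < 2 * n" "e = relabel \<rho> (sq_edge n a)"
      using T(1) by (auto simp: sq_copy_def sq_edges_def)
    have "s \<notin> sq_edge n a" "(s + n - 1) mod n \<notin> sq_edge n a"
      using s e by (auto simp: a(2) relabel_def)
    from sq_edge_rotation[OF n s(1) a(1) this] obtain b where
      b: "b \<in> {..<2 * n} - {0, 1, 3}" "sq_edge n a = rot ` sq_edge n b"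
      by (auto simp: rot_def)
    have "e = relabel (\<rho> \<circ> rot) (sq_edge n b)"
      by (simp add: a(2) b(2) relabel_def image_image)
    then show "e \<in> relabel (\<rho> \<circ> rot) ` sq_edge n ` ({..<2 * n} - {0, 1, 3})" using b(1) by blast
  qed
  ultimately show ?thesis by blast
qed

section \<open>Two rounds of exposure\<close>

abbreviation perms :: "nat \<Rightarrow> (nat \<Rightarrow> nat) set" where
  "perms n \<equiv> {\<tau>. \<tau> permutes {..<n}}"

lemma card_perms: "card (perms n) = fact n"
  by (simp add: card_permutations)

lemma finite_perms: "finite (perms n)"
  by (simp add: finite_permutations)

lemma finite_all_edges: "finite V \<Longrightarrow> finite (all_edges V)"
  by (rule finite_subset[of _ "Pow V"]) (auto simp: all_edges_def)

text \<open>The constant \<open>1152 = 24 * 48\<close> makes the weight parameter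
  \<open>l = 1 / 24\<close>. The sum then grows by at most \<open>exp (sqrt n / 3)\<close>, which is
  less than the gain \<open>exp (sqrt n / 2)\<close> from large sets.\<close>

lemma sum_sq_copy_le:
  assumes \<rho>: "\<rho> \<in> perms n" and n: "48 \<le> n" and k: "sqrt n \<le> real k"
  shows "(\<Sum>T | T \<subseteq> sq_copy n \<rho> \<and> k \<le> card T.
      (1 / (1152 / sqrt n)) ^ card T * card {\<tau> \<in> perms n. T \<subseteq> sq_copy n \<tau>})
    \<le> fact n * real n ^ 3 * exp (- sqrt n / 6)"
proof -
  define p where "p = 1152 / sqrt (real n)"
  define m where "m = 1 / sqrt (real n)"
  have sn: "0 < sqrt (real n)" using n by simp
  have p: "0 < p" using sn by (simp add: p_def)
  define f where "f = (\<lambda>a. relabel \<rho> (sq_edge n a))"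
  have copy: "sq_copy n \<rho> = f ` {..<2 * n}"
    by (auto simp: sq_copy_def sq_edges_def f_def)
  define w where "w = (\<lambda>J. fact n * real n ^ 3 * run_weight (1 / 24) m J)"
  have w: "(1 / p) ^ card J * card {\<tau> \<in> perms n. f ` J \<subseteq> sq_copy n \<tau>} \<le> w J"
    if "J \<subseteq> {..<2 * n}" for J
  proof -
    have "(1 / p) ^ card J * card {\<tau> \<in> perms n. f ` J \<subseteq> sq_copy n \<tau>} \<le>
        (1 / p) ^ card J * (fact n * real n ^ 3 * run_weight (48 / sqrt n) m J)"
      using card_sq_copy_containing_le'[OF _ n that, of \<rho>] \<rho> p
      by (intro mult_left_mono) (auto simp: m_def f_def image_image)
    also have "\<dots> = fact n * real n ^ 3 * ((1 / p) ^ card J * run_weight (48 / sqrt n) m J)"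
      by simp
    also have "(1 / p) * (48 / sqrt n) = 1 / 24" using sn by (simp add: p_def)
    then have "(1 / p) ^ card J * run_weight (48 / sqrt n) m J = run_weight (1 / 24) m J"
      by (simp only: run_weight_scale)
    finally show ?thesis by (simp add: w_def)
  qed
  have "(\<Sum>T | T \<subseteq> sq_copy n \<rho> \<and> k \<le> card T.
      (1 / p) ^ card T * card {\<tau> \<in> perms n. T \<subseteq> sq_copy n \<tau>})
    \<le> (\<Sum>J | J \<subseteq> {..<2 * n} \<and> k \<le> card J. w J)"
  proof (rule sum_le_included[where i = "image f"])
    show "finite {T. T \<subseteq> sq_copy n \<rho> \<and> k \<le> card T}"
      unfolding copy by (rule finite_subset[of _ "Pow (f ` {..<2 * n})"]) auto
    show "finite {J. J \<subseteq> {..<2 * n} \<and> k \<le> card J}"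
      by (rule finite_subset[of _ "Pow {..<2 * n}"]) auto
    show "\<forall>J\<in>{J. J \<subseteq> {..<2 * n} \<and> k \<le> card J}. 0 \<le> w J"
      by (auto simp: w_def m_def intro!: mult_nonneg_nonneg run_weight_nonneg)
    show "\<forall>T\<in>{T. T \<subseteq> sq_copy n \<rho> \<and> k \<le> card T}. \<exists>J\<in>{J. J \<subseteq> {..<2 * n} \<and> k \<le> card J}.
      f ` J = T \<and> (1 / p) ^ card T * card {\<tau> \<in> perms n. T \<subseteq> sq_copy n \<tau>} \<le> w J"
    proof
      fix T assume "T \<in> {T. T \<subseteq> sq_copy n \<rho> \<and> k \<le> card T}"
      then have T: "T \<subseteq> f ` {..<2 * n}" "k \<le> card T" by (auto simp: copy)
      \<comment> \<open>Each \<open>T\<close> is represented by one set of numbers mapped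
        injectively onto it; such a set exists whether or not \<open>f\<close> is injective.\<close>
      from T(1) obtain J where J: "J \<subseteq> {..<2 * n}" "inj_on f J" "T = f ` J"
        by (auto simp: subset_image_inj)
      have "card T = card J" using J by (simp add: card_image)
      then show "\<exists>J\<in>{J. J \<subseteq> {..<2 * n} \<and> k \<le> card J}.
        f ` J = T \<and> (1 / p) ^ card T * card {\<tau> \<in> perms n. T \<subseteq> sq_copy n \<tau>} \<le> w J"
        using J T(2) w[OF J(1)] by (intro bexI[of _ J]) simp_all
    qed
  qed
  also have "\<dots> = fact n * real n ^ 3 * (\<Sum>J | J \<subseteq> {..<2 * n} \<and> k \<le> card J. run_weight (1 / 24) m J)"
    by (simp add: w_def sum_distrib_left)
  also have "\<dots> \<le> fact n * real n ^ 3 * ((1 / 2) ^ k * (1 + 4 * (1 / 24) * m) ^ card {..<2 * n})"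
    by (intro mult_left_mono sum_large_run_weight_le) (auto simp: m_def)
  also have "\<dots> \<le> fact n * real n ^ 3 * (exp (- sqrt n / 2) * exp (sqrt n / 3))"
  proof (intro mult_left_mono mult_mono)
    have "(1 / 2) ^ k \<le> exp (- real k / 2)" by (rule power_half_le_exp)
    also have "\<dots> \<le> exp (- sqrt n / 2)" using k by simp
    finally show "(1 / 2) ^ k \<le> exp (- sqrt n / 2)" .
    have "(1 + 4 * (1 / 24) * m) ^ card {..<2 * n} \<le> exp (real (card {..<2 * n}) * (4 * (1 / 24) * m))"
      by (rule power_one_plus_le_exp) (simp add: m_def)
    also have "real (card {..<2 * n}) * (4 * (1 / 24) * m) = sqrt n / 3"
      using sn by (simp add: m_def field_simps)
    finally show "(1 + 4 * (1 / 24) * m) ^ card {..<2 * n} \<le> exp (sqrt n / 3)" .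
  qed (auto simp: m_def)
  also have "exp (- sqrt n / 2) * exp (sqrt n / 3) = exp (- sqrt n / 6)"
    by (simp flip: exp_add)
  finally show ?thesis by (simp add: p_def)
qed

text \<open>For a small fragment the expected overlap is small: \<open>288 \<le> K\<close> gives
  \<open>6 * (48 / K) \<le> 1\<close>, and \<open>card T \<le> sqrt n\<close> cancels
  \<open>m\<close>, leaving the exponent \<open>2 * 48 / K\<close>.\<close>

lemma sum_overlap_le:
  assumes n: "48 \<le> n" and p: "0 < p" and K: "288 \<le> K" "K / sqrt n \<le> p"
    and \<rho>: "\<rho> \<in> perms n" and T: "T \<subseteq> sq_copy n \<rho>" "real (card T) \<le> sqrt n"
  shows "(\<Sum>I\<in>Pow T - {{}}. (1 / p) ^ card I * card {\<tau> \<in> perms n. I \<subseteq> sq_copy n \<tau>})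
    \<le> fact n * (exp (96 / K) - 1)"
proof -
  define m where "m = 1 / sqrt (real n)"
  have sn: "0 < sqrt (real n)" using n by simp
  have "4 < sqrt (real n)" using n by (intro real_less_rsqrt) auto
  then have "4 * sqrt (real n) < sqrt (real n) * sqrt (real n)" using sn by (intro mult_strict_right_mono)
  then have "4 * real (card T) < real n" using T(2) by simp
  then have "4 * card T < n" by linarith
  then obtain \<rho>' where \<rho>': "\<rho>' permutes {..<n}"
    "T \<subseteq> relabel \<rho>' ` sq_edge n ` ({..<2 * n} - {0, 1, 3})"
    using sq_copy_unwrap[OF _ _ T(1)] \<rho> n by auto
  define f where "f = (\<lambda>a. relabel \<rho>' (sq_edge n a))"
  have "T \<subseteq> f ` ({..<2 * n} - {0, 1, 3})" using \<rho>'(2) by (simp add: f_def image_image)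
  then obtain A where A: "A \<subseteq> {..<2 * n} - {0, 1, 3}" "inj_on f A" "T = f ` A"
    unfolding subset_image_inj by blast
  have finA: "finite A" using A(1) finite_subset by blast
  have cardA: "card A = card T" using A by (simp add: card_image)
  define w where "w = (\<lambda>J. fact n * run_weight (48 / K) m J)"
  have w: "(1 / p) ^ card J * card {\<tau> \<in> perms n. f ` J \<subseteq> sq_copy n \<tau>} \<le> w J"
    if "J \<subseteq> A" for J
  proof -
    have J: "J \<subseteq> {..<2 * n} - {0, 1, 3}" using that A(1) by blast
    have "(1 / p) ^ card J * card {\<tau> \<in> perms n. f ` J \<subseteq> sq_copy n \<tau>} \<le>
        (1 / p) ^ card J * (fact n * run_weight (48 / sqrt n) m J)"
      using card_sq_copy_containing_le[OF \<rho>'(1) n J] p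
      by (intro mult_left_mono) (auto simp: m_def f_def image_image)
    also have "\<dots> = fact n * run_weight ((1 / p) * (48 / sqrt n)) m J"
      unfolding run_weight_scale[symmetric] by simp
    also have "\<dots> \<le> w J" unfolding w_def
    proof (intro mult_left_mono run_weight_mono)
      have "K \<le> p * sqrt n" using K(2) sn by (simp add: pos_divide_le_eq)
      then show "(1 / p) * (48 / sqrt n) \<le> 48 / K"
        using K(1) p sn by (simp add: field_simps)
    qed (use p in \<open>auto simp: m_def\<close>)
    finally show ?thesis .
  qed
  have w0: "0 \<le> w J" for J
    using K unfolding w_def by (intro mult_nonneg_nonneg run_weight_nonneg) (auto simp: m_def)
  have "(\<Sum>I\<in>Pow T - {{}}. (1 / p) ^ card I * card {\<tau> \<in> perms n. I \<subseteq> sq_copy n \<tau>})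
    \<le> (\<Sum>J\<in>Pow A - {{}}. w J)"
  proof (rule sum_le_included[where i = "image f"])
    show "finite (Pow T - {{}})" "finite (Pow A - {{}})" using finA A(3) by auto
    show "\<forall>I\<in>Pow T - {{}}. \<exists>J\<in>Pow A - {{}}. f ` J = I \<and>
      (1 / p) ^ card I * card {\<tau> \<in> perms n. I \<subseteq> sq_copy n \<tau>} \<le> w J"
    proof
      fix I assume I: "I \<in> Pow T - {{}}"
      then obtain J where J: "J \<subseteq> A" "inj_on f J" "I = f ` J"
        unfolding A(3) by (auto simp: subset_image_inj)
      have "card I = card J" using J by (simp add: card_image)
      then show "\<exists>J\<in>Pow A - {{}}. f ` J = I \<and>
          (1 / p) ^ card I * card {\<tau> \<in> perms n. I \<subseteq> sq_copy n \<tau>} \<le> w J"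
        using I J w[OF J(1)] by (intro bexI[of _ J]) auto
    qed
  qed (use w0 in auto)
  also have "\<dots> = sum w (Pow A) - w {}" using finA by (subst sum_diff) auto
  also have "\<dots> = fact n * ((\<Sum>J\<in>Pow A. run_weight (48 / K) m J) - 1)"
    by (simp add: w_def algebra_simps sum_distrib_left)
  also have "\<dots> \<le> fact n * (exp (96 / K) - 1)"
  proof (intro mult_left_mono diff_mono order_refl)
    have "(\<Sum>J\<in>Pow A. run_weight (48 / K) m J) \<le> (1 + 2 * (48 / K) * m) ^ card A"
      using finA K by (intro sum_run_weight_le) (auto simp: m_def)
    also have "\<dots> \<le> exp (real (card A) * (2 * (48 / K) * m))"
      using K by (intro power_one_plus_le_exp) (auto simp: m_def)
    also have "\<dots> \<le> exp (96 / K)"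
    proof -
      have "real (card A) * m \<le> 1" using T(2) sn by (simp add: cardA m_def)
      then have "(96 / K) * (real (card A) * m) \<le> (96 / K) * 1" using K by (intro mult_left_mono) auto
      then show ?thesis by (simp add: mult_ac)
    qed
    finally show "(\<Sum>J\<in>Pow A. run_weight (48 / K) m J) \<le> exp (96 / K)" .
  qed simp
  finally show ?thesis .
qed

lemma bern_exp_small_fragments:
  assumes n: "48 \<le> n" and p: "0 < p" "p \<le> 1" and K: "288 \<le> K" "K / sqrt n \<le> p"
    and G: "G \<subseteq> perms n" "fact n \<le> 2 * real (card G)"
    and T: "\<And>\<tau>. \<tau> \<in> G \<Longrightarrow> T \<tau> \<subseteq> sq_copy n \<tau>" "\<And>\<tau>. \<tau> \<in> G \<Longrightarrow> real (card (T \<tau>)) \<le> sqrt n"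
  shows "1 - 2 * (exp (96 / K) - 1) \<le>
    bern_exp p (all_edges {1..n}) (\<lambda>W. of_bool (\<exists>\<tau>\<in>G. T \<tau> \<subseteq> W))"
proof (rule bern_exp_second_moment)
  define g where "g = exp (96 / K) - 1"
  have g: "0 \<le> g" using K by (simp add: g_def)
  have finG: "finite G" using G(1) finite_perms finite_subset by blast
  show "finite G" by fact
  show "finite (all_edges {1..n})" by (simp add: finite_all_edges)
  show "G \<noteq> {}"
  proof
    assume "G = {}"
    with G(2) have "fact n \<le> (0 :: real)" by simp
    then show False using fact_gt_zero[of n, where ?'a = real] by linarith
  qed
  show TX: "T \<tau> \<subseteq> all_edges {1..n}" if "\<tau> \<in> G" for \<tau>
    using T(1)[OF that] sq_copy_subset[of \<tau> n] G(1) that n by auto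
  have finT: "finite (T \<tau>)" if "\<tau> \<in> G" for \<tau>
    using TX[OF that] finite_all_edges finite_subset by blast
  have row: "(\<Sum>\<sigma>\<in>G. (1 / p) ^ card (T \<tau> \<inter> T \<sigma>)) \<le> real (card G) + fact n * g"
    if \<tau>: "\<tau> \<in> G" for \<tau>
  proof -
    let ?I = "Pow (T \<tau>) - {{}}"
    have finI: "finite ?I" using finT[OF \<tau>] by simp
    \<comment> \<open>Overlaps are bounded by summing over all nonempty subsets of
      \<open>T \<tau>\<close> inside the whole copy of \<open>\<sigma>\<close>. This removes the
      dependence on the arbitrary \<open>T \<sigma>\<close>.\<close>
    have "(\<Sum>\<sigma>\<in>G. (1 / p) ^ card (T \<tau> \<inter> T \<sigma>)) \<le>
        (\<Sum>\<sigma>\<in>G. 1 + (\<Sum>I\<in>?I. (1 / p) ^ card I * of_bool (I \<subseteq> sq_copy n \<sigma>)))"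
    proof (rule sum_mono)
      fix \<sigma> assume \<sigma>: "\<sigma> \<in> G"
      let ?h = "\<lambda>I. (1 / p) ^ card I * of_bool (I \<subseteq> sq_copy n \<sigma>)"
      have nonneg: "0 \<le> ?h I" for I using p by simp
      show "(1 / p) ^ card (T \<tau> \<inter> T \<sigma>) \<le> 1 + sum ?h ?I"
      proof (cases "T \<tau> \<inter> T \<sigma> = {}")
        case True
        then show ?thesis using sum_nonneg[of ?I ?h] nonneg by simp
      next
        case False
        then have "?h (T \<tau> \<inter> T \<sigma>) \<le> sum ?h ?I"
          using finI nonneg by (intro member_le_sum) auto
        moreover have "T \<tau> \<inter> T \<sigma> \<subseteq> sq_copy n \<sigma>" using T(1)[OF \<sigma>] by auto
        ultimately show ?thesis by simp
      qed
    qed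
    also have "\<dots> = real (card G) + (\<Sum>\<sigma>\<in>G. \<Sum>I\<in>?I. (1 / p) ^ card I * of_bool (I \<subseteq> sq_copy n \<sigma>))"
      by (simp add: sum.distrib)
    also have "(\<Sum>\<sigma>\<in>G. \<Sum>I\<in>?I. (1 / p) ^ card I * of_bool (I \<subseteq> sq_copy n \<sigma>)) =
        (\<Sum>I\<in>?I. (1 / p) ^ card I * (\<Sum>\<sigma>\<in>G. of_bool (I \<subseteq> sq_copy n \<sigma>)))"
      by (subst sum.swap) (simp only: sum_distrib_left)
    also have "\<dots> \<le> (\<Sum>I\<in>?I. (1 / p) ^ card I * card {\<sigma> \<in> perms n. I \<subseteq> sq_copy n \<sigma>})"
    proof (intro sum_mono mult_left_mono)
      fix I
      have "(\<Sum>\<sigma>\<in>G. of_bool (I \<subseteq> sq_copy n \<sigma>)) = real (card {\<sigma> \<in> G. I \<subseteq> sq_copy n \<sigma>})"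
        using finG by (simp add: of_bool_def sum.If_cases Int_def)
      also have "\<dots> \<le> card {\<sigma> \<in> perms n. I \<subseteq> sq_copy n \<sigma>}"
        using G(1) finite_perms[of n] by (intro of_nat_mono card_mono) auto
      finally show "(\<Sum>\<sigma>\<in>G. of_bool (I \<subseteq> sq_copy n \<sigma>)) \<le> real (card {\<sigma> \<in> perms n. I \<subseteq> sq_copy n \<sigma>})" .
    qed (use p in auto)
    also have "\<dots> \<le> fact n * g"
      unfolding g_def using G(1) \<tau> T by (intro sum_overlap_le n p K) auto
    finally show ?thesis by simp
  qed
  have "(\<Sum>\<tau>\<in>G. \<Sum>\<sigma>\<in>G. (1 / p) ^ card (T \<tau> \<inter> T \<sigma>)) \<le> (\<Sum>\<tau>\<in>G. real (card G) + fact n * g)"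
    by (intro sum_mono row)
  also have "\<dots> = real (card G) * (real (card G) + fact n * g)" by simp
  also have "\<dots> \<le> real (card G) * (real (card G) + (2 * real (card G)) * g)"
    using G(2) g by (intro mult_left_mono add_left_mono mult_right_mono) auto
  also have "\<dots> = (1 + 2 * g) * (real (card G))\<^sup>2" by (simp add: power2_eq_square algebra_simps)
  finally show "(\<Sum>\<tau>\<in>G. \<Sum>\<sigma>\<in>G. (1 / p) ^ card (T \<tau> \<inter> T \<sigma>)) \<le>
      (1 + 2 * (exp (96 / K) - 1)) * (real (card G))\<^sup>2" by (simp add: g_def)
qed (use p in auto)

lemma prob_gnp:
  assumes "0 \<le> p" "p \<le> 1"
  shows "measure_pmf.prob (gnp n p) {G. Q G} =
    bern_exp p (all_edges {1..n}) (\<lambda>W. of_bool (Q (Graph {1..n} W)))"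
  using prob_Pi_pmf_bernoulli[OF finite_all_edges assms, of "{1..n}" "\<lambda>W. Q (Graph {1..n} W)"]
  by (simp add: gnp_def vimage_def)

lemma prob_gnp_contains_ham_cycle_square_ge:
  assumes n: "48 \<le> n" "1152 < sqrt n" and \<delta>: "0 < \<delta>" "\<delta> \<le> 1 / 2"
    and small: "2 * (real n ^ 3 * exp (- sqrt n / 6)) \<le> \<delta>"
    and p: "(1152 + 384 / \<delta>) / sqrt n \<le> p" "p \<le> 1"
  shows "1 - 2 * \<delta> \<le> measure_pmf.prob (gnp n p) {G. contains_ham_cycle_square G}"
proof -
  define p1 where "p1 = 1152 / sqrt n"
  define p2 where "p2 = (p - p1) / (1 - p1)"
  \<comment> \<open>Chosen so that \<open>96 / K = \<delta> / 4\<close>, whence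
    \<open>2 * (exp (96 / K) - 1) \<le> \<delta>\<close> by \<open>exp z \<le> 1 + 2 * z\<close> for
    small \<open>z\<close>.\<close>
  define K where "K = 384 / \<delta>"
  define X where "X = all_edges {1..n}"
  define k where "k = nat \<lceil>sqrt n\<rceil>"
  define Q where "Q = (\<lambda>W. contains_ham_cycle_square (Graph {1..n} W))"
  define bad where "bad = (\<lambda>W. real (card {\<tau> \<in> perms n. k \<le> card (fragment (sq_copy n) (perms n) \<tau> W)}))"
  have sn: "0 < sqrt (real n)" using n by simp
  have p1: "0 < p1" "p1 < 1" using n sn by (auto simp: p1_def)
  have K: "288 \<le> K" using \<delta> by (simp add: K_def field_simps)
  have pp1: "K / sqrt n \<le> p - p1" using p(1) by (simp add: p1_def K_def add_divide_distrib)
  have "0 < K / sqrt n" using K sn by simp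
  then have pp1': "0 < p - p1" using pp1 by linarith
  have "(p - p1) * (1 - p1) \<le> p - p1" using pp1' p1 by (simp add: mult_left_le)
  then have "p - p1 \<le> p2" using p1 by (simp add: p2_def pos_le_divide_eq)
  then have p2: "0 < p2" "p2 \<le> 1" "K / sqrt n \<le> p2"
    using pp1 pp1' p1 p(2) by (auto simp: p2_def)
  have p0: "0 \<le> p" using pp1' p1 by linarith
  have split: "1 - p = (1 - p1) * (1 - p2)" using p1 by (simp add: p2_def field_simps)
  have finX: "finite X" by (simp add: X_def finite_all_edges)
  have k: "sqrt n \<le> real k" "\<And>x. x < k \<Longrightarrow> real x \<le> sqrt n"
  proof -
    show "sqrt n \<le> real k" by (simp add: k_def real_nat_ceiling_ge)
    show "real x \<le> sqrt n" if "x < k" for x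
      using that unfolding k_def by linarith
  qed
  have g: "2 * (exp (96 / K) - 1) \<le> \<delta>"
    using exp_bound_lemma[of "96 / K"] \<delta> by (simp add: K_def)
  have E: "bern_exp p1 X bad \<le> fact n * real n ^ 3 * exp (- sqrt n / 6)"
    unfolding bad_def
  proof (rule bern_exp_large_fragments[OF finX])
    fix \<rho> assume "\<rho> \<in> perms n"
    from sum_sq_copy_le[OF this n(1) k(1)]
    show "(\<Sum>T | T \<subseteq> sq_copy n \<rho> \<and> k \<le> card T.
        (1 / p1) ^ card T * card {\<tau> \<in> perms n. T \<subseteq> sq_copy n \<tau>})
      \<le> fact n * real n ^ 3 * exp (- sqrt n / 6)" by (simp add: p1_def)
  qed (use p1 n finite_perms sq_copy_subset in \<open>auto simp: X_def\<close>)
  \<comment> \<open>A linear form of Markov's inequality: the left side is nonpositive when at least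
    half of the permutations are bad, and at most \<open>1 - \<delta>\<close> otherwise. Holding for
    every \<open>W\<close>, it can be averaged over the first round.\<close>
  have inner: "(1 - \<delta>) * (1 - 2 / fact n * bad W) \<le> bern_exp p2 X (\<lambda>W'. of_bool (Q (W \<union> W')))" for W
  proof (cases "fact n \<le> 2 * bad W")
    case True
    then have "1 - 2 / fact n * bad W \<le> 0" by (simp add: field_simps)
    then have "(1 - \<delta>) * (1 - 2 / fact n * bad W) \<le> 0" using \<delta> by (intro mult_nonneg_nonpos) auto
    also have "0 = bern_exp p2 X (\<lambda>_. 0)" using finX by simp
    also have "\<dots> \<le> bern_exp p2 X (\<lambda>W'. of_bool (Q (W \<union> W')))"
      using p2 by (intro bern_exp_mono) auto
    finally show ?thesis .
  next
    case False
    let ?T = "\<lambda>\<tau>. fragment (sq_copy n) (perms n) \<tau> W"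
    define G where "G = {\<tau> \<in> perms n. card (?T \<tau>) < k}"
    have "perms n - G = {\<tau> \<in> perms n. k \<le> card (?T \<tau>)}" by (auto simp: G_def)
    then have "bad W = real (card (perms n - G))" by (simp add: bad_def)
    also have "\<dots> = fact n - real (card G)"
    proof -
      have "G \<subseteq> perms n" by (auto simp: G_def)
      then have "real (card (perms n - G)) + real (card G) = real (card (perms n))"
        using finite_perms[of n] finite_subset[of G] card_Diff_subset[of G "perms n"]
          card_mono[of "perms n" G] by simp
      then show ?thesis unfolding card_perms of_nat_fact by linarith
    qed
    finally have cG: "fact n \<le> 2 * real (card G)" using False by simp
    have "(1 - \<delta>) * (1 - 2 / fact n * bad W) \<le> 1 - \<delta>"
      using \<delta> by (intro mult_left_le) (auto simp: bad_def)
    also have "\<dots> \<le> 1 - 2 * (exp (96 / K) - 1)" using g by simp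
    also have "\<dots> \<le> bern_exp p2 X (\<lambda>W'. of_bool (\<exists>\<tau>\<in>G. ?T \<tau> \<subseteq> W'))"
      unfolding X_def
      by (rule bern_exp_small_fragments[OF n(1) p2(1,2) K p2(3) _ cG])
        (use fragment_props(1)[where I = "perms n" and S = "sq_copy n"] k(2) in \<open>auto simp: G_def\<close>)
    also have "\<dots> \<le> bern_exp p2 X (\<lambda>W'. of_bool (Q (W \<union> W')))"
    proof (intro bern_exp_mono)
      fix W'
      have "Q (W \<union> W')" if \<tau>: "\<tau> \<in> G" "?T \<tau> \<subseteq> W'" for \<tau>
      proof -
        obtain \<sigma> where "\<sigma> \<in> perms n" "sq_copy n \<sigma> \<subseteq> ?T \<tau> \<union> W"
          using fragment_props(3)[of \<tau> "perms n" "sq_copy n" W] \<tau>(1) by (auto simp: G_def)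
        then show ?thesis unfolding Q_def
          using \<tau>(2) n(1) by (intro contains_ham_cycle_square_if_sq_copy[of \<sigma>]) auto
      qed
      then show "of_bool (\<exists>\<tau>\<in>G. ?T \<tau> \<subseteq> W') \<le> (of_bool (Q (W \<union> W')) :: real)" by auto
    qed (use p2 in auto)
    finally show ?thesis .
  qed
  have "1 - 2 * \<delta> \<le> (1 - \<delta>) * (1 - \<delta>)" by (simp add: algebra_simps)
  also have "\<dots> \<le> (1 - \<delta>) * (1 - 2 / fact n * bern_exp p1 X bad)"
  proof (intro mult_left_mono diff_left_mono)
    have "2 / fact n * bern_exp p1 X bad \<le> 2 / fact n * (fact n * real n ^ 3 * exp (- sqrt n / 6))"
      using E by (intro mult_left_mono) auto
    also have "\<dots> \<le> \<delta>" using small by simp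
    finally show "2 / fact n * bern_exp p1 X bad \<le> \<delta>" .
  qed (use \<delta> in auto)
  also have "\<dots> = bern_exp p1 X (\<lambda>W. (1 - \<delta>) * (1 - 2 / fact n * bad W))"
    using finX by (simp only: bern_exp_cmult bern_exp_diff bern_exp_const)
  also have "\<dots> \<le> bern_exp p1 X (\<lambda>W. bern_exp p2 X (\<lambda>W'. of_bool (Q (W \<union> W'))))"
    using p1 inner by (intro bern_exp_mono) auto
  also have "\<dots> = bern_exp p X (\<lambda>W. of_bool (Q W))"
    by (rule bern_exp_Un[OF finX split, symmetric])
  also have "\<dots> = measure_pmf.prob (gnp n p) {G. contains_ham_cycle_square G}"
    using prob_gnp[OF p0 p(2), of n contains_ham_cycle_square] by (simp add: X_def Q_def)
  finally show ?thesis .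
qed

theorem theorem1p2:
  fixes \<epsilon> :: real
  assumes "\<epsilon> > 0"
  shows "\<exists>K::real. K > 0 \<and>
           (\<forall>\<^sub>F n :: nat in sequentially. \<forall>p::real. 0 \<le> p \<and> p \<le> 1 \<and> p \<ge> K / sqrt (real n) \<longrightarrow>
              measure_pmf.prob (gnp n p) {G. contains_ham_cycle_square G} \<ge> 1 - \<epsilon>)"
proof -
  define \<delta> where "\<delta> = min \<epsilon> 1 / 2"
  have \<delta>: "0 < \<delta>" "\<delta> \<le> 1 / 2" "2 * \<delta> \<le> \<epsilon>" using assms by (auto simp: \<delta>_def)
  have "(\<lambda>n::nat. 2 * (real n ^ 3 * exp (- sqrt n / 6))) \<longlonglongrightarrow> 0" by real_asymp
  then have "\<forall>\<^sub>F n :: nat in sequentially. 2 * (real n ^ 3 * exp (- sqrt n / 6)) < \<delta>"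
    using \<delta>(1) by (rule order_tendstoD)
  moreover have "\<forall>\<^sub>F n :: nat in sequentially. 1152 < sqrt (real n)" by real_asymp
  moreover have "\<forall>\<^sub>F n :: nat in sequentially. 48 \<le> n" by (rule eventually_ge_at_top)
  ultimately have "\<forall>\<^sub>F n :: nat in sequentially. \<forall>p::real. 0 \<le> p \<and> p \<le> 1 \<and>
      p \<ge> (1152 + 384 / \<delta>) / sqrt (real n) \<longrightarrow>
      measure_pmf.prob (gnp n p) {G. contains_ham_cycle_square G} \<ge> 1 - \<epsilon>"
  proof eventually_elim
    case (elim n)
    show ?case
    proof (intro allI impI)
      fix p :: real
      assume "0 \<le> p \<and> p \<le> 1 \<and> p \<ge> (1152 + 384 / \<delta>) / sqrt (real n)"
      then have "1 - 2 * \<delta> \<le> measure_pmf.prob (gnp n p) {G. contains_ham_cycle_square G}"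
        using elim \<delta> by (intro prob_gnp_contains_ham_cycle_square_ge) auto
      then show "measure_pmf.prob (gnp n p) {G. contains_ham_cycle_square G} \<ge> 1 - \<epsilon>"
        using \<delta>(3) by linarith
    qed
  qed
  moreover have "0 < 1152 + 384 / \<delta>" using \<delta>(1) by (simp add: add_pos_pos)
  ultimately show ?thesis by blast
qed

end
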